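(* Let $\widetilde F^k$ be the L-SVRG estimator (see context), and let $\hat\Delta_k:=\frac1{b_k}\mathbb{E}_\xi[\|\mathbf F(x^k,\xi)-\mathbf F(\tilde x^k,\xi)\|^2]$ for $b_k\ge b_{k-1}$. Then, for any $\tau>0$, $$\mathbb{E}_k[\|\widetilde F^k-Fx^k\|^2]\le(1+\tau)\,\mathbb{E}_k[\hat\Delta_k]+\tfrac{1+\tau}{\tau}\,\mathbb{E}_k[\|\bar F\tilde x^k-F\tilde x^k\|^2].$$ For any $\alpha\in(0,1)$ and $\bar{\mathcal E}_k:=\mathbb{E}_\xi[\|\mathbf F(x^k,\xi)-\mathbf F(x^{k-1},\xi)\|^2]$, $$\mathbb{E}_k[\hat\Delta_k]\le(1-\alpha\mathbf p_k)\hat\Delta_{k-1}+\frac{1}{(1-\alpha)b_k\mathbf p_k}\,\bar{\mathcal E}_k.$$ Consequently, $\widetilde F^k$ satisfies the $\mathbf{VR}(\Delta_k;\kappa_k,\Theta_k,\sigma_k)$ property (see context) with $$\Delta_k:=2\hat\Delta_k+\tfrac{2\sigma^2}{n_k},\quad \kappa_k:=\alpha\mathbf p_k,\quad \Theta_k:=\tfrac{2}{(1-\alpha)b_k\mathbf p_k},\quad \sigma_k^2:=\tfrac{2\alpha\mathbf p_k\sigma^2}{n_k}.$$ In particular, if $\bar F\tilde x^k:=F\tilde x^k$, then $\widetilde F^k$ satisfies the $\mathbf{VR}(\Delta_k;\kappa_k,\Theta_k,\sigma_k)$ property with $\Delta_k:=\hat\Delta_k$, $\kappa_k:=\alpha\mathbf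 p_k$, $\Theta_k:=\frac1{(1-\alpha)b_k\mathbf p_k}$, and $\sigma_k^2:=0$.
   Context: Setting: $F:\mathbb{R}^p\to\mathbb{R}^p$ with either $Fx=\frac1n\sum_{i=1}^nF_ix$ (finite-sum setting; then $\mathbf F(x,\xi)$ means $F_ix$ with $i$ uniform on $\{1,\dots,n\}$) or $Fx=\mathbb{E}_\xi[\mathbf F(x,\xi)]$ (expectation setting), where $\mathbb{E}_\xi[\|\mathbf F(x,\xi)-Fx\|^2]\le\sigma^2$ for all $x\in\mathrm{dom}(F)$. $\{x^k\}_{k\ge0}$ is a given sequence of iterates (with $x^{-1}:=x^0$). $\mathcal F_k$ is the $\sigma$-algebra generated by all randomness up to the current iterates $x^0,\dots,x^k$ (not including the random draws made at iteration $k$, which are made independently given $\mathcal F_k$); $\mathbb{E}_k[\cdot]=\mathbb{E}[\cdot\mid\mathcal F_k]$. In $\mathbb{E}_\xi$, $\xi$ is a fresh copy independent of everything else. L-SVRG (loopless SVRG) estimator: $\widetilde F^k:=\bar F\tilde x^k+\mathbf F(x^k,\mathcal S_k)-\mathbf F(\tilde x^k,\mathcal S_k)$, with $\mathbf F(\cdot,\mathcal S_k):=\frac1{b_k}\sum_{\xi_i\in\mathcal S_k}\mathbf F(\cdot,\xi_i)$ for an i.i.d. sample $\mathcal S_k$ of size $b_k$; $\tilde x^0:=x^0$ and, for $k\ge1$, $\tilde x^k:=x^{k-1}$ with probability $\mathbf p_k$ and $\tilde x^k:=\tilde x^{k-1}$ with probability $1-\mathbf p_k$, where $\mathbf p_k\in[\underline{\mathbf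 p},1)$, $\underline{\mathbf p}>0$. The quantity $\bar F\tilde x^k$ is either the full-batch evaluation $F\tilde x^k$, or a mega-batch evaluation $\frac1{n_k}\sum_{\xi\in\bar{\mathcal S}_k}\mathbf F(\tilde x^k,\xi)$ with a mega-batch $\bar{\mathcal S}_k$ of size $n_k$, $n_k\ge n_{k-1}$, for which $\mathbb{E}_{\bar{\mathcal S}_k}[\bar F\tilde x^k]=F\tilde x^k$ and $\mathbb{E}_{\bar{\mathcal S}_k}[\|\bar F\tilde x^k-F\tilde x^k\|^2]\le\sigma^2/n_k$. $\mathbf{VR}(\Delta_k;\kappa_k,\Theta_k,\sigma_k)$ property, for parameters $\kappa_k\in(0,1]$, $\Theta_k\ge0$, $\sigma_k\ge0$ and a random quantity $\Delta_k\ge0$: almost surely, for all $k\ge0$, $\mathbb{E}_k[\|\widetilde F^k-Fx^k\|^2]\le\mathbb{E}_k[\Delta_k]$ and $\mathbb{E}_k[\Delta_k]\le(1-\kappa_k)\Delta_{k-1}+\Theta_k\bar{\mathcal E}_k+\sigma_k^2$, where $x^{-1}:=x^0$ and $\Delta_{-1}:=0$.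
   Formalization: The "Consequently" clause fails at k=0 when σ>0 (it would need 2σ²/n_0 ≤ 2αp_0σ²/n_0); it is proved instead with Δ_{-1}:=2σ²/n_0, and also with Δ_{-1}:=0 but σ_0²:=2σ²/n_0; all k≥1 are unchanged. *)

theory Defs
  imports "HOL-Probability.Probability"
begin

text \<open>
  \<open>FF y \<xi>\<close> is the stochastic oracle, \<open>D\<close> the law of \<open>\<xi>\<close>.  In the finite-sum setting the index set is
  an arbitrary nonempty finite set \<open>I\<close> with \<open>n = card I\<close> elements and \<open>\<xi>\<close> is uniform on it.
\<close>

definition finite_sum_setting ::
  "'s measure \<Rightarrow> (real ^ 'p \<Rightarrow> 's \<Rightarrow> real ^ 'p) \<Rightarrow> (real ^ 'p \<Rightarrow> real ^ 'p) \<Rightarrow> bool" where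
  "finite_sum_setting D FF F \<longleftrightarrow>
     (\<exists>I. finite I \<and> I \<noteq> {} \<and> D = uniform_count_measure I \<and>
          (\<forall>y. F y = (1 / real (card I)) *\<^sub>R (\<Sum>i\<in>I. FF y i)))"

definition expectation_setting ::
  "'s measure \<Rightarrow> (real ^ 'p \<Rightarrow> 's \<Rightarrow> real ^ 'p) \<Rightarrow> (real ^ 'p \<Rightarrow> real ^ 'p) \<Rightarrow> real \<Rightarrow> bool" where
  "expectation_setting D FF F \<sigma> \<longleftrightarrow>
     prob_space D \<and>
     (\<forall>y. integrable D (FF y) \<and> F y = (LINT \<xi>|D. FF y \<xi>)) \<and>
     (\<forall>y. integrable D (\<lambda>\<xi>. (norm (FF y \<xi> - F y))\<^sup>2) \<and>
          (LINT \<xi>|D. (norm (FF y \<xi> - F y))\<^sup>2) \<le> \<sigma>\<^sup>2)"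

definition batch_mean ::
  "(real ^ 'p \<Rightarrow> 's \<Rightarrow> real ^ 'p) \<Rightarrow> nat \<Rightarrow> (nat \<Rightarrow> 's) \<Rightarrow> real ^ 'p \<Rightarrow> real ^ 'p" where
  "batch_mean FF m s y = (1 / real m) *\<^sub>R (\<Sum>i<m. FF y (s i))"

text \<open>The reference points: \<open>coin k\<close> says whether the anchor is refreshed at iteration \<open>k \<ge> 1\<close>
  (\<open>coin 0\<close> is drawn but never used).\<close>

primrec anchor :: "(nat \<Rightarrow> 'w \<Rightarrow> bool) \<Rightarrow> (nat \<Rightarrow> 'w \<Rightarrow> 'v) \<Rightarrow> nat \<Rightarrow> 'w \<Rightarrow> 'v" where
  "anchor coin x 0 \<omega> = x 0 \<omega>"
| "anchor coin x (Suc k) \<omega> = (if coin (Suc k) \<omega> then x k \<omega> else anchor coin x k \<omega>)"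

text \<open>
  The draws of iteration \<open>k\<close>: the coin, the mini-batch \<open>S k \<omega>\<close> (a \<open>b k\<close>-tuple) and the mega-batch
  \<open>Sbar k \<omega>\<close> (an \<open>n k\<close>-tuple; irrelevant, e.g. constant, when full batches are used).
\<close>

definition draw_space ::
  "'s measure \<Rightarrow> (nat \<Rightarrow> nat) \<Rightarrow> (nat \<Rightarrow> nat) \<Rightarrow> nat \<Rightarrow> (bool \<times> (nat \<Rightarrow> 's) \<times> (nat \<Rightarrow> 's)) measure" where
  "draw_space D b n k =
     count_space UNIV \<Otimes>\<^sub>M (Pi\<^sub>M {..<b k} (\<lambda>_. D) \<Otimes>\<^sub>M Pi\<^sub>M {..<n k} (\<lambda>_. D))"

definition draws ::
  "(nat \<Rightarrow> 'w \<Rightarrow> bool) \<Rightarrow> (nat \<Rightarrow> 'w \<Rightarrow> nat \<Rightarrow> 's) \<Rightarrow> (nat \<Rightarrow> 'w \<Rightarrow> nat \<Rightarrow> 's) \<Rightarrow>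
   nat \<Rightarrow> 'w \<Rightarrow> bool \<times> (nat \<Rightarrow> 's) \<times> (nat \<Rightarrow> 's)" where
  "draws coin S Sbar k \<omega> = (coin k \<omega>, S k \<omega>, Sbar k \<omega>)"

text \<open>
  \<open>G k\<close> contains the iterates up to \<open>x k\<close> and all draws of the iterations before \<open>k\<close>.  It may be larger
  than the \<open>\<sigma>\<close>-algebra they generate, to allow for further randomness used by the algorithm.
\<close>

definition history ::
  "'w measure \<Rightarrow> 's measure \<Rightarrow> (nat \<Rightarrow> nat) \<Rightarrow> (nat \<Rightarrow> nat) \<Rightarrow> (nat \<Rightarrow> 'w \<Rightarrow> real ^ 'p) \<Rightarrow>
   (nat \<Rightarrow> 'w \<Rightarrow> bool) \<Rightarrow> (nat \<Rightarrow> 'w \<Rightarrow> nat \<Rightarrow> 's) \<Rightarrow> (nat \<Rightarrow> 'w \<Rightarrow> nat \<Rightarrow> 's) \<Rightarrow>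
   (nat \<Rightarrow> 'w measure) \<Rightarrow> bool" where
  "history M D b n x coin S Sbar G \<longleftrightarrow>
     (\<forall>k. subalgebra M (G k) \<and> sets (G k) \<subseteq> sets (G (Suc k)) \<and>
          x k \<in> borel_measurable (G k) \<and>
          draws coin S Sbar k \<in> measurable (G (Suc k)) (draw_space D b n k))"

text \<open>
  The draws of iteration \<open>k\<close> are independent of \<open>G k\<close>; among themselves (product law) coin, mini-batch
  and mega-batch are independent, the coin is Bernoulli and the mini-batch is i.i.d. with law \<open>D\<close>.
  The law of the mega-batch is left open.
\<close>

definition fresh_draws ::
  "'w measure \<Rightarrow> 's measure \<Rightarrow> (nat \<Rightarrow> nat) \<Rightarrow> (nat \<Rightarrow> nat) \<Rightarrow> (nat \<Rightarrow> real) \<Rightarrow>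
   (nat \<Rightarrow> 'w \<Rightarrow> bool) \<Rightarrow> (nat \<Rightarrow> 'w \<Rightarrow> nat \<Rightarrow> 's) \<Rightarrow> (nat \<Rightarrow> 'w \<Rightarrow> nat \<Rightarrow> 's) \<Rightarrow>
   (nat \<Rightarrow> 'w measure) \<Rightarrow> bool" where
  "fresh_draws M D b n p coin S Sbar G \<longleftrightarrow>
     (\<forall>k. prob_space.indep_set M (sets (G k))
            {draws coin S Sbar k -` A \<inter> space M | A. A \<in> sets (draw_space D b n k)} \<and>
          distr M (draw_space D b n k) (draws coin S Sbar k) =
            measure_pmf (bernoulli_pmf (p k)) \<Otimes>\<^sub>M
              (Pi\<^sub>M {..<b k} (\<lambda>_. D) \<Otimes>\<^sub>M distr M (Pi\<^sub>M {..<n k} (\<lambda>_. D)) (Sbar k)))"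

text \<open>The two admissible choices of the anchor value \<open>Fbar k\<close>.\<close>

definition full_batch ::
  "'w measure \<Rightarrow> (real ^ 'p \<Rightarrow> real ^ 'p) \<Rightarrow> (nat \<Rightarrow> 'w \<Rightarrow> bool) \<Rightarrow> (nat \<Rightarrow> 'w \<Rightarrow> real ^ 'p) \<Rightarrow>
   (nat \<Rightarrow> 'w \<Rightarrow> real ^ 'p) \<Rightarrow> bool" where
  "full_batch M F coin x Fbar \<longleftrightarrow> (\<forall>k. \<forall>\<omega>\<in>space M. Fbar k \<omega> = F (anchor coin x k \<omega>))"

text \<open>The expectation over the mega-batch alone: \<open>\<omega>'\<close> ranges over its draw while the anchor is frozen
  at its value for \<open>\<omega>\<close>.\<close>

definition mega_batch ::
  "'w measure \<Rightarrow> (real ^ 'p \<Rightarrow> 's \<Rightarrow> real ^ 'p) \<Rightarrow> (real ^ 'p \<Rightarrow> real ^ 'p) \<Rightarrow> (nat \<Rightarrow> nat) \<Rightarrow> real \<Rightarrow>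
   (nat \<Rightarrow> 'w \<Rightarrow> bool) \<Rightarrow> (nat \<Rightarrow> 'w \<Rightarrow> nat \<Rightarrow> 's) \<Rightarrow> (nat \<Rightarrow> 'w \<Rightarrow> real ^ 'p) \<Rightarrow>
   (nat \<Rightarrow> 'w \<Rightarrow> real ^ 'p) \<Rightarrow> bool" where
  "mega_batch M FF F n \<sigma> coin Sbar x Fbar \<longleftrightarrow>
     (\<forall>k. \<forall>\<omega>\<in>space M. Fbar k \<omega> = batch_mean FF (n k) (Sbar k \<omega>) (anchor coin x k \<omega>)) \<and>
     (\<forall>k. AE \<omega> in M.
        integrable M (\<lambda>\<omega>'. batch_mean FF (n k) (Sbar k \<omega>') (anchor coin x k \<omega>)) \<and>
        (LINT \<omega>'|M. batch_mean FF (n k) (Sbar k \<omega>') (anchor coin x k \<omega>)) = F (anchor coin x k \<omega>) \<and>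
        integrable M (\<lambda>\<omega>'. (norm (batch_mean FF (n k) (Sbar k \<omega>') (anchor coin x k \<omega>)
                                    - F (anchor coin x k \<omega>)))\<^sup>2) \<and>
        (LINT \<omega>'|M. (norm (batch_mean FF (n k) (Sbar k \<omega>') (anchor coin x k \<omega>)
                            - F (anchor coin x k \<omega>)))\<^sup>2) \<le> \<sigma>\<^sup>2 / real (n k))"

definition lsvrg_estimator ::
  "(real ^ 'p \<Rightarrow> 's \<Rightarrow> real ^ 'p) \<Rightarrow> (nat \<Rightarrow> nat) \<Rightarrow> (nat \<Rightarrow> 'w \<Rightarrow> bool) \<Rightarrow>
   (nat \<Rightarrow> 'w \<Rightarrow> nat \<Rightarrow> 's) \<Rightarrow> (nat \<Rightarrow> 'w \<Rightarrow> real ^ 'p) \<Rightarrow> (nat \<Rightarrow> 'w \<Rightarrow> real ^ 'p) \<Rightarrow>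
   nat \<Rightarrow> 'w \<Rightarrow> real ^ 'p" where
  "lsvrg_estimator FF b coin S Fbar x k \<omega> =
     Fbar k \<omega> + batch_mean FF (b k) (S k \<omega>) (x k \<omega>)
       - batch_mean FF (b k) (S k \<omega>) (anchor coin x k \<omega>)"

definition mean_sq_diff ::
  "'s measure \<Rightarrow> (real ^ 'p \<Rightarrow> 's \<Rightarrow> real ^ 'p) \<Rightarrow> real ^ 'p \<Rightarrow> real ^ 'p \<Rightarrow> real" where
  "mean_sq_diff D FF y z = (LINT \<xi>|D. (norm (FF y \<xi> - FF z \<xi>))\<^sup>2)"

definition Delta_hat ::
  "'s measure \<Rightarrow> (real ^ 'p \<Rightarrow> 's \<Rightarrow> real ^ 'p) \<Rightarrow> (nat \<Rightarrow> nat) \<Rightarrow> (nat \<Rightarrow> 'w \<Rightarrow> bool) \<Rightarrow>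
   (nat \<Rightarrow> 'w \<Rightarrow> real ^ 'p) \<Rightarrow> nat \<Rightarrow> 'w \<Rightarrow> real" where
  "Delta_hat D FF b coin x k \<omega> =
     (1 / real (b k)) * mean_sq_diff D FF (x k \<omega>) (anchor coin x k \<omega>)"

text \<open>Truncated subtraction gives the convention \<open>x\<^sup>-\<^sup>1 = x\<^sup>0\<close>.\<close>

definition E_bar ::
  "'s measure \<Rightarrow> (real ^ 'p \<Rightarrow> 's \<Rightarrow> real ^ 'p) \<Rightarrow> (nat \<Rightarrow> 'w \<Rightarrow> real ^ 'p) \<Rightarrow> nat \<Rightarrow> 'w \<Rightarrow> real" where
  "E_bar D FF x k \<omega> = mean_sq_diff D FF (x k \<omega>) (x (k - 1) \<omega>)"

text \<open>Conditional expectation of a nonnegative real random variable, with values in \<open>[0, \<infinity>]\<close>, so that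
  no integrability of the iterates is needed.\<close>

abbreviation cond_E :: "'w measure \<Rightarrow> 'w measure \<Rightarrow> ('w \<Rightarrow> real) \<Rightarrow> 'w \<Rightarrow> ennreal" where
  "cond_E M H f \<equiv> nn_cond_exp M H (\<lambda>\<omega>. ennreal (f \<omega>))"

text \<open>\<open>prev d \<Delta> k\<close> is \<open>\<Delta>\<close> at index \<open>k - 1\<close>, where \<open>d\<close> is the value at index \<open>-1\<close>.\<close>

definition prev :: "real \<Rightarrow> (nat \<Rightarrow> 'w \<Rightarrow> real) \<Rightarrow> nat \<Rightarrow> 'w \<Rightarrow> real" where
  "prev d \<Delta> k \<omega> = (case k of 0 \<Rightarrow> d | Suc j \<Rightarrow> \<Delta> j \<omega>)"

definition VR_property_init ::
  "real \<Rightarrow> 'w measure \<Rightarrow> (nat \<Rightarrow> 'w measure) \<Rightarrow> (real ^ 'p \<Rightarrow> real ^ 'p) \<Rightarrow> (nat \<Rightarrow> 'w \<Rightarrow> real ^ 'p) \<Rightarrow>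
   (nat \<Rightarrow> 'w \<Rightarrow> real) \<Rightarrow> (nat \<Rightarrow> 'w \<Rightarrow> real ^ 'p) \<Rightarrow>
   (nat \<Rightarrow> 'w \<Rightarrow> real) \<Rightarrow> (nat \<Rightarrow> real) \<Rightarrow> (nat \<Rightarrow> real) \<Rightarrow> (nat \<Rightarrow> real) \<Rightarrow> bool" where
  "VR_property_init d M G F x Eb Ft \<Delta> \<kappa> \<Theta> s \<longleftrightarrow>
     (\<forall>k. 0 < \<kappa> k \<and> \<kappa> k \<le> 1 \<and> 0 \<le> \<Theta> k \<and> 0 \<le> s k) \<and>
     (\<forall>k. \<Delta> k \<in> borel_measurable M \<and> (\<forall>\<omega>\<in>space M. 0 \<le> \<Delta> k \<omega>)) \<and>
     (AE \<omega> in M. \<forall>k.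
        cond_E M (G k) (\<lambda>\<omega>. (norm (Ft k \<omega> - F (x k \<omega>)))\<^sup>2) \<omega> \<le> cond_E M (G k) (\<Delta> k) \<omega> \<and>
        cond_E M (G k) (\<Delta> k) \<omega>
          \<le> ennreal ((1 - \<kappa> k) * prev d \<Delta> k \<omega> + \<Theta> k * Eb k \<omega> + (s k)\<^sup>2))"

text \<open>
  The \<open>VR\<close> property proper has the initial value \<open>0\<close> at index \<open>-1\<close>.  For
  \<open>\<Delta> k = 2 * Dhat k + 2 * \<sigma>\<^sup>2 / n k\<close>, where \<open>Dhat\<close> and \<open>Eb\<close> vanish at \<open>k = 0\<close>, its second inequality
  at \<open>k = 0\<close> amounts to \<open>2 * \<sigma>\<^sup>2 / n 0 \<le> (s 0)\<^sup>2\<close>, so it fails for \<open>(s 0)\<^sup>2 = 2 * \<alpha> * p 0 * \<sigma>\<^sup>2 / n 0\<close>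
  unless \<open>\<sigma> = 0\<close>; with the initial value \<open>2 * \<sigma>\<^sup>2 / n 0\<close> it holds.
\<close>

abbreviation VR_property ::
  "'w measure \<Rightarrow> (nat \<Rightarrow> 'w measure) \<Rightarrow> (real ^ 'p \<Rightarrow> real ^ 'p) \<Rightarrow> (nat \<Rightarrow> 'w \<Rightarrow> real ^ 'p) \<Rightarrow>
   (nat \<Rightarrow> 'w \<Rightarrow> real) \<Rightarrow> (nat \<Rightarrow> 'w \<Rightarrow> real ^ 'p) \<Rightarrow>
   (nat \<Rightarrow> 'w \<Rightarrow> real) \<Rightarrow> (nat \<Rightarrow> real) \<Rightarrow> (nat \<Rightarrow> real) \<Rightarrow> (nat \<Rightarrow> real) \<Rightarrow> bool" where
  "VR_property \<equiv> VR_property_init 0"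

end

theory Submission
  imports Defs
begin

text \<open>
  Conditionally on the history \<open>G k\<close> everything about iteration \<open>k\<close> is frozen except its three draws,
  and these are independent of the history and of each other.  The anchor is then one of two fixed
  points, \<open>x (k - 1)\<close> with probability \<open>p k\<close> and the previous anchor with probability \<open>1 - p k\<close>, so
  each conditional expectation is an explicit two-term mixture of integrals over the mini-batch and
  the mega-batch (\<open>cond_exp_draws\<close>, which rests on \<open>nn_cond_exp_independent_argument\<close>).

  The error of the estimator splits into the mini-batch noise and the error of the value used at the
  anchor.  For fixed points the noise is a mean of \<open>b k\<close> centered i.i.d. vectors, whose second moment
  is \<open>1 / b k\<close> times a variance, hence at most the quantity whose mixture is the conditional
  expectation of \<open>Delta_hat\<close> (\<open>cond_exp_noise\<close>).  Young's inequality joins the two parts for an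
  arbitrary anchor value, even one correlated with the mini-batch, at the price of the factor \<open>1 + \<tau>\<close>
  (\<open>cond_exp_estimator\<close>).

  For the recursion, the refreshed branch of the mixture contributes only the step from \<open>x (k - 1)\<close>
  to \<open>x k\<close>, while on the other branch Young's inequality trades a small inflation of the old distance
  for a large multiple of the step.  The free parameter is chosen so that the coin's contraction
  \<open>1 - p k\<close> times the inflation is exactly \<open>1 - \<alpha> * p k\<close> (\<open>cond_exp_Dh_recursion\<close>).  The variance
  reduction properties follow with \<open>\<tau> = 1\<close>; with full batches the anchor error vanishes and Young's
  inequality is skipped.
\<close>

section \<open>Conditioning on an independent argument\<close>

text \<open>
  The freezing rule: under the conditional expectation an independent variable may be integrated out
  with the known argument held fixed.  It follows from Fubini's theorem, once the joint law of the
  identity map into \<open>G\<close> and of \<open>T\<close> is recognised as a product; taking the sample point itself as the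
  known argument lets \<open>f\<close> use any number of \<open>G\<close>-measurable quantities at once.
\<close>

lemma (in prob_space) nn_cond_exp_independent_argument:
  assumes sub: "subalgebra M G" and T [measurable]: "T \<in> measurable M N"
    and indep: "indep_set (sets G) {T -` A \<inter> space M | A. A \<in> sets N}"
    and f [measurable]: "f \<in> borel_measurable (G \<Otimes>\<^sub>M N)"
  shows "AE \<omega> in M. nn_cond_exp M G (\<lambda>\<omega>. f (\<omega>, T \<omega>)) \<omega> = (\<integral>\<^sup>+t. f (\<omega>, t) \<partial>distr M N T)"
proof -
  interpret finite_measure_subalgebra M G
    by (intro finite_measure_subalgebra.intro finite_measure_subalgebra_axioms.intro sub) unfold_locales
  interpret T: prob_space "distr M N T" by (rule prob_space_distr) fact
  have id [measurable]: "(\<lambda>\<omega>. \<omega>) \<in> measurable M G"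
    using sub by (intro measurableI) (auto simp: subalgebra_def)
  have sp: "space G = space M" using sub by (simp add: subalgebra_def)
  interpret id: prob_space "distr M G (\<lambda>\<omega>. \<omega>)" by (rule prob_space_distr) fact
  have law: "distr M (G \<Otimes>\<^sub>M N) (\<lambda>\<omega>. (\<omega>, T \<omega>)) = distr M G (\<lambda>\<omega>. \<omega>) \<Otimes>\<^sub>M distr M N T"
  proof (rule pair_measure_eqI[symmetric])
    fix A B assume A: "A \<in> sets (distr M G (\<lambda>\<omega>. \<omega>))" and B: "B \<in> sets (distr M N T)"
    then have [measurable]: "A \<in> sets G" "B \<in> sets N" and AM: "A \<subseteq> space M"
      using sets.sets_into_space[of A G] by (auto simp: sp)
    have "prob (A \<inter> (T -` B \<inter> space M)) = prob A * prob (T -` B \<inter> space M)"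
      using A B by (intro indep_setD[OF indep]) auto
    moreover have "(\<lambda>\<omega>. (\<omega>, T \<omega>)) -` (A \<times> B) \<inter> space M = A \<inter> (T -` B \<inter> space M)"
      using AM by auto
    moreover have "(\<lambda>\<omega>. \<omega>) -` A \<inter> space M = A" using AM by auto
    ultimately show "emeasure (distr M G (\<lambda>\<omega>. \<omega>)) A * emeasure (distr M N T) B
        = emeasure (distr M (G \<Otimes>\<^sub>M N) (\<lambda>\<omega>. (\<omega>, T \<omega>))) (A \<times> B)"
      by (simp add: emeasure_distr emeasure_eq_measure ennreal_mult)
  qed (unfold_locales, simp cong: sets_pair_measure_cong)
  have "AE \<omega> in M. (\<integral>\<^sup>+t. f (\<omega>, t) \<partial>distr M N T) = nn_cond_exp M G (\<lambda>\<omega>. f (\<omega>, T \<omega>)) \<omega>"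
  proof (rule nn_cond_exp_charact)
    fix A assume A [measurable]: "A \<in> sets G"
    have "(\<integral>\<^sup>+\<omega>\<in>A. f (\<omega>, T \<omega>) \<partial>M)
        = (\<integral>\<^sup>+z. f z * indicator A (fst z) \<partial>distr M (G \<Otimes>\<^sub>M N) (\<lambda>\<omega>. (\<omega>, T \<omega>)))"
      by (subst nn_integral_distr) simp_all
    also have "\<dots> = (\<integral>\<^sup>+\<omega>. \<integral>\<^sup>+t. f (\<omega>, t) * indicator A \<omega> \<partial>distr M N T \<partial>distr M G (\<lambda>\<omega>. \<omega>))"
      unfolding law by (subst T.nn_integral_fst[symmetric]) simp_all
    also have "\<dots> = (\<integral>\<^sup>+\<omega>. (\<integral>\<^sup>+t. f (\<omega>, t) \<partial>distr M N T) * indicator A \<omega> \<partial>distr M G (\<lambda>\<omega>. \<omega>))"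
      by (intro nn_integral_cong nn_integral_multc) simp
    also have "\<dots> = (\<integral>\<^sup>+\<omega>\<in>A. (\<integral>\<^sup>+t. f (\<omega>, t) \<partial>distr M N T) \<partial>M)"
      by (subst nn_integral_distr) simp_all
    finally show "(\<integral>\<^sup>+\<omega>\<in>A. f (\<omega>, T \<omega>) \<partial>M)
        = (\<integral>\<^sup>+\<omega>\<in>A. (\<integral>\<^sup>+t. f (\<omega>, t) \<partial>distr M N T) \<partial>M)" .
  qed simp_all
  then show ?thesis by eventually_elim simp
qed

section \<open>Second moments of sums of centered vectors\<close>

text \<open>The difference of the two sides is the square of \<open>\<tau> *\<^sub>R a - b\<close> divided by \<open>\<tau>\<close>.\<close>

lemma norm_add_power2_le_Young:
  fixes a b :: "'v :: real_inner"
  assumes "0 < \<tau>"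
  shows "(norm (a + b))\<^sup>2 \<le> (1 + \<tau>) * (norm a)\<^sup>2 + ((1 + \<tau>) / \<tau>) * (norm b)\<^sup>2"
proof -
  have "0 \<le> (norm (\<tau> *\<^sub>R a - b))\<^sup>2 / \<tau>" using assms by simp
  also have "\<dots> = \<tau> * (norm a)\<^sup>2 - 2 * (a \<bullet> b) + (norm b)\<^sup>2 / \<tau>"
    using assms unfolding power2_norm_eq_inner inner_diff_left inner_diff_right
    by (simp add: inner_commute field_simps)
  finally show ?thesis
    using assms unfolding power2_norm_eq_inner inner_add_left inner_add_right
    by (simp add: inner_commute field_simps)
qed

lemma (in prob_space) nn_integral_norm_add_centered:
  fixes Y :: "'a \<Rightarrow> 'v :: euclidean_space"
  assumes Y: "integrable M Y" "expectation Y = 0" "integrable M (\<lambda>\<xi>. (norm (Y \<xi>))\<^sup>2)"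
  shows "(\<integral>\<^sup>+\<xi>. ennreal ((norm (a + Y \<xi>))\<^sup>2) \<partial>M)
    = ennreal ((norm a)\<^sup>2) + (\<integral>\<^sup>+\<xi>. ennreal ((norm (Y \<xi>))\<^sup>2) \<partial>M)"
proof -
  have eq: "(norm (a + Y \<xi>))\<^sup>2 = (norm a)\<^sup>2 + 2 * (a \<bullet> Y \<xi>) + (norm (Y \<xi>))\<^sup>2" for \<xi>
    by (simp add: power2_norm_eq_inner inner_add_left inner_add_right inner_commute)
  have int: "integrable M (\<lambda>\<xi>. (norm (a + Y \<xi>))\<^sup>2)"
    unfolding eq using Y by (intro Bochner_Integration.integrable_add integrable_mult_right
        integrable_inner_right) simp_all
  have "expectation (\<lambda>\<xi>. (norm (a + Y \<xi>))\<^sup>2) = (norm a)\<^sup>2 + expectation (\<lambda>\<xi>. (norm (Y \<xi>))\<^sup>2)"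
    unfolding eq using Y by (simp add: prob_space)
  then show ?thesis
    using int Y(3) by (simp add: nn_integral_eq_integral)
qed

text \<open>
  Integrating the coordinates out one at a time, each new summand is centered and independent of the
  others, so its cross term with the partial sum vanishes by \<open>nn_integral_norm_add_centered\<close>.
  Working with nonnegative integrals, no integrability on the product space has to be established.
\<close>

lemma (in prob_space) nn_integral_norm_sum_iid_centered:
  fixes Y :: "'a \<Rightarrow> 'v :: euclidean_space"
  assumes Y: "integrable M Y" "expectation Y = 0" "integrable M (\<lambda>\<xi>. (norm (Y \<xi>))\<^sup>2)"
    and "finite I"
  shows "(\<integral>\<^sup>+s. ennreal ((norm (\<Sum>i\<in>I. Y (s i)))\<^sup>2) \<partial>Pi\<^sub>M I (\<lambda>_. M))
    = of_nat (card I) * (\<integral>\<^sup>+\<xi>. ennreal ((norm (Y \<xi>))\<^sup>2) \<partial>M)"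
  using \<open>finite I\<close>
proof induction
  case empty
  show ?case by simp
next
  case (insert j J)
  interpret P: product_prob_space "\<lambda>_. M" J by unfold_locales
  have [measurable]: "Y \<in> borel_measurable M" using Y(1) by simp
  let ?v = "\<integral>\<^sup>+\<xi>. ennreal ((norm (Y \<xi>))\<^sup>2) \<partial>M"
  have "(\<integral>\<^sup>+s. ennreal ((norm (\<Sum>i\<in>insert j J. Y (s i)))\<^sup>2) \<partial>Pi\<^sub>M (insert j J) (\<lambda>_. M))
      = (\<integral>\<^sup>+s. \<integral>\<^sup>+\<xi>. ennreal ((norm (\<Sum>i\<in>insert j J. Y ((s(j := \<xi>)) i)))\<^sup>2) \<partial>M \<partial>Pi\<^sub>M J (\<lambda>_. M))"
    by (rule P.product_nn_integral_insert) (use insert in \<open>simp_all\<close>)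
  also have "\<dots> = (\<integral>\<^sup>+s. \<integral>\<^sup>+\<xi>. ennreal ((norm ((\<Sum>i\<in>J. Y (s i)) + Y \<xi>))\<^sup>2) \<partial>M \<partial>Pi\<^sub>M J (\<lambda>_. M))"
  proof (intro nn_integral_cong)
    fix s \<xi>
    have "(\<Sum>i\<in>J. Y ((s(j := \<xi>)) i)) = (\<Sum>i\<in>J. Y (s i))"
      using insert by (intro sum.cong) auto
    then show "ennreal ((norm (\<Sum>i\<in>insert j J. Y ((s(j := \<xi>)) i)))\<^sup>2)
        = ennreal ((norm ((\<Sum>i\<in>J. Y (s i)) + Y \<xi>))\<^sup>2)"
      using insert by (simp add: add.commute)
  qed
  also have "\<dots> = (\<integral>\<^sup>+s. ennreal ((norm (\<Sum>i\<in>J. Y (s i)))\<^sup>2) + ?v \<partial>Pi\<^sub>M J (\<lambda>_. M))"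
    by (simp add: nn_integral_norm_add_centered[OF Y])
  also have "\<dots> = (\<integral>\<^sup>+s. ennreal ((norm (\<Sum>i\<in>J. Y (s i)))\<^sup>2) \<partial>Pi\<^sub>M J (\<lambda>_. M)) + ?v"
    by (subst nn_integral_add) (simp_all add: P.emeasure_space_1)
  also have "\<dots> = of_nat (card (insert j J)) * ?v"
    using insert by (simp add: distrib_right add.commute)
  finally show ?case .
qed

section \<open>The stochastic oracle\<close>

text \<open>
  The common ground of the finite-sum and the expectation setting: an unbiased oracle with finite
  second moments.
\<close>

locale square_integrable_oracle = prob_space D
  for D :: "'s measure" +
  fixes FF :: "real ^ 'p \<Rightarrow> 's \<Rightarrow> real ^ 'p" and F :: "real ^ 'p \<Rightarrow> real ^ 'p"
  assumes FF_measurable: "(\<lambda>(y, \<xi>). FF y \<xi>) \<in> borel_measurable (borel \<Otimes>\<^sub>M D)"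
    and FF_square: "integrable D (\<lambda>\<xi>. (norm (FF y \<xi>))\<^sup>2)"
    and F_eq: "F y = (LINT \<xi>|D. FF y \<xi>)"
begin

lemma measurable_FF [measurable (raw)]:
  assumes "f \<in> borel_measurable A" "g \<in> measurable A D"
  shows "(\<lambda>w. FF (f w) (g w)) \<in> borel_measurable A"
  using measurable_compose[OF measurable_Pair[OF assms] FF_measurable] by simp

lemma measurable_F [measurable]: "F \<in> borel_measurable borel"
proof -
  have "(\<lambda>y. LINT \<xi>|D. FF y \<xi>) \<in> borel_measurable borel" by measurable
  then show ?thesis by (simp add: F_eq[abs_def])
qed

lemma measurable_mean_sq_diff [measurable (raw)]:
  assumes [measurable]: "f \<in> borel_measurable A" "g \<in> borel_measurable A"
  shows "(\<lambda>w. mean_sq_diff D FF (f w) (g w)) \<in> borel_measurable A"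
  unfolding mean_sq_diff_def by measurable

lemma FF_integrable: "integrable D (FF y)"
proof (rule Bochner_Integration.integrable_bound)
  show "integrable D (\<lambda>\<xi>. 1 + (norm (FF y \<xi>))\<^sup>2)"
    using FF_square by simp
  have "t \<le> 1 + t\<^sup>2" for t :: real
    using zero_le_power2[of "t - 1 / 2"] by (simp add: power2_eq_square algebra_simps)
  then show "AE \<xi> in D. norm (FF y \<xi>) \<le> norm (1 + (norm (FF y \<xi>))\<^sup>2)"
    by simp
qed measurable

lemma FF_diff_square: "integrable D (\<lambda>\<xi>. (norm (FF y \<xi> - FF z \<xi>))\<^sup>2)"
proof (rule Bochner_Integration.integrable_bound)
  show "integrable D (\<lambda>\<xi>. 2 * (norm (FF y \<xi>))\<^sup>2 + 2 * (norm (FF z \<xi>))\<^sup>2)"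
    using FF_square by simp
  have "(norm (FF y \<xi> - FF z \<xi>))\<^sup>2 \<le> 2 * (norm (FF y \<xi>))\<^sup>2 + 2 * (norm (FF z \<xi>))\<^sup>2" for \<xi>
    using norm_add_power2_le_Young[of 1 "FF y \<xi>" "- FF z \<xi>"] by simp
  then show "AE \<xi> in D. norm ((norm (FF y \<xi> - FF z \<xi>))\<^sup>2)
      \<le> norm (2 * (norm (FF y \<xi>))\<^sup>2 + 2 * (norm (FF z \<xi>))\<^sup>2)"
    by (intro AE_I2) (simp add: order_trans[OF _ abs_ge_self])
qed measurable

lemma measurable_batch_mean [measurable (raw)]:
  assumes f [measurable]: "f \<in> borel_measurable A" and g: "g \<in> measurable A (Pi\<^sub>M {..<m} (\<lambda>_. D))"
  shows "(\<lambda>w. batch_mean FF m (g w) (f w)) \<in> borel_measurable A"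
proof -
  have [measurable]: "(\<lambda>w. g w i) \<in> measurable A D" if "i \<in> {..<m}" for i
    using measurable_compose[OF g measurable_component_singleton[OF that]] .
  show ?thesis unfolding batch_mean_def by measurable
qed

lemma mean_sq_diff_nonneg: "0 \<le> mean_sq_diff D FF y z"
  by (simp add: mean_sq_diff_def)

lemma mean_sq_diff_self [simp]: "mean_sq_diff D FF y y = 0"
  by (simp add: mean_sq_diff_def)

lemma mean_sq_diff_le_Young:
  assumes "0 < \<tau>"
  shows "mean_sq_diff D FF y z
    \<le> (1 + \<tau>) * mean_sq_diff D FF w z + ((1 + \<tau>) / \<tau>) * mean_sq_diff D FF y w"
proof -
  have "(norm (FF y \<xi> - FF z \<xi>))\<^sup>2
      \<le> (1 + \<tau>) * (norm (FF w \<xi> - FF z \<xi>))\<^sup>2 + ((1 + \<tau>) / \<tau>) * (norm (FF y \<xi> - FF w \<xi>))\<^sup>2" for \<xi>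
    using norm_add_power2_le_Young[OF assms, of "FF w \<xi> - FF z \<xi>" "FF y \<xi> - FF w \<xi>"] by simp
  then have "mean_sq_diff D FF y z \<le> (LINT \<xi>|D. (1 + \<tau>) * (norm (FF w \<xi> - FF z \<xi>))\<^sup>2
        + ((1 + \<tau>) / \<tau>) * (norm (FF y \<xi> - FF w \<xi>))\<^sup>2)"
    unfolding mean_sq_diff_def
    by (intro integral_mono) (simp_all add: FF_diff_square del: times_divide_eq_left)
  also have "\<dots> = (1 + \<tau>) * mean_sq_diff D FF w z + ((1 + \<tau>) / \<tau>) * mean_sq_diff D FF y w"
    unfolding mean_sq_diff_def
    by (simp add: FF_diff_square del: times_divide_eq_left)
  finally show ?thesis .
qed

text \<open>
  The left-hand side is \<open>1 / m\<close> times the variance of \<open>FF y - FF z\<close>, and a variance is at most the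
  second moment.
\<close>

lemma batch_difference_variance:
  assumes "1 \<le> m"
  shows "(\<integral>\<^sup>+s. ennreal ((norm (batch_mean FF m s y - batch_mean FF m s z - (F y - F z)))\<^sup>2)
      \<partial>Pi\<^sub>M {..<m} (\<lambda>_. D)) \<le> ennreal (1 / real m * mean_sq_diff D FF y z)"
proof -
  define \<mu> where "\<mu> = F y - F z"
  define Y where "Y \<xi> = FF y \<xi> - FF z \<xi> - \<mu>" for \<xi>
  have Yi: "integrable D Y" unfolding Y_def[abs_def] by (simp add: FF_integrable)
  have [measurable]: "Y \<in> borel_measurable D" using Yi by simp
  have Y0: "expectation Y = 0"
    by (simp add: Y_def[abs_def] \<mu>_def F_eq FF_integrable prob_space)
  have exp_eq: "(norm (FF y \<xi> - FF z \<xi>))\<^sup>2 = (norm (Y \<xi>))\<^sup>2 + 2 * (\<mu> \<bullet> Y \<xi>) + (norm \<mu>)\<^sup>2" for \<xi>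
    by (simp add: Y_def power2_norm_eq_inner inner_diff_left inner_diff_right inner_commute algebra_simps)
  have Ysq: "(norm (Y \<xi>))\<^sup>2 = (norm (FF y \<xi> - FF z \<xi>))\<^sup>2 - 2 * (\<mu> \<bullet> Y \<xi>) - (norm \<mu>)\<^sup>2" for \<xi>
    by (simp add: exp_eq)
  have Y2: "integrable D (\<lambda>\<xi>. (norm (Y \<xi>))\<^sup>2)"
    unfolding Ysq using FF_diff_square[of y z] Yi by simp
  have le: "expectation (\<lambda>\<xi>. (norm (Y \<xi>))\<^sup>2) \<le> mean_sq_diff D FF y z"
    unfolding mean_sq_diff_def exp_eq using Y2 Yi Y0 by (simp add: prob_space)
  have "batch_mean FF m s y - batch_mean FF m s z - (F y - F z)
      = (1 / real m) *\<^sub>R (\<Sum>i<m. Y (s i))" for s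
    using assms
    by (simp add: batch_mean_def Y_def \<mu>_def[symmetric] sum_subtractf sum_constant_scaleR
        scaleR_diff_right del: sum_constant)
  then have "(\<integral>\<^sup>+s. ennreal ((norm (batch_mean FF m s y - batch_mean FF m s z - (F y - F z)))\<^sup>2)
      \<partial>Pi\<^sub>M {..<m} (\<lambda>_. D))
     = (\<integral>\<^sup>+s. ennreal ((1 / real m)\<^sup>2) * ennreal ((norm (\<Sum>i<m. Y (s i)))\<^sup>2) \<partial>Pi\<^sub>M {..<m} (\<lambda>_. D))"
    by (simp add: power_divide power_mult_distrib ennreal_mult[symmetric])
  also have "\<dots> = ennreal ((1 / real m)\<^sup>2) * (of_nat m * (\<integral>\<^sup>+\<xi>. ennreal ((norm (Y \<xi>))\<^sup>2) \<partial>D))"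
    by (subst nn_integral_cmult) (simp_all add: nn_integral_norm_sum_iid_centered[OF Yi Y0 Y2])
  also have "\<dots> = ennreal ((1 / real m)\<^sup>2 * (real m * expectation (\<lambda>\<xi>. (norm (Y \<xi>))\<^sup>2)))"
    using Y2 by (simp add: nn_integral_eq_integral ennreal_of_nat_eq_real_of_nat ennreal_mult)
  also have "\<dots> = ennreal (1 / real m * expectation (\<lambda>\<xi>. (norm (Y \<xi>))\<^sup>2))"
    using assms by (simp add: power2_eq_square)
  also have "\<dots> \<le> ennreal (1 / real m * mean_sq_diff D FF y z)"
    using le by (intro ennreal_leI mult_left_mono) simp_all
  finally show ?thesis .
qed

end

lemma square_integrable_oracleI:
  assumes FF: "(\<lambda>(y, \<xi>). FF y \<xi>) \<in> borel_measurable (borel \<Otimes>\<^sub>M D)"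
    and setting: "finite_sum_setting D FF F \<or> expectation_setting D FF F \<sigma>"
  shows "square_integrable_oracle D FF F"
  using setting
proof
  assume "finite_sum_setting D FF F"
  then obtain I where I: "finite I" "I \<noteq> {}" and D: "D = uniform_count_measure I"
    and F: "\<And>y. F y = (1 / real (card I)) *\<^sub>R (\<Sum>i\<in>I. FF y i)"
    unfolding finite_sum_setting_def by auto
  interpret prob_space D unfolding D by (rule prob_space_uniform_count_measure) fact+
  show ?thesis
  proof (intro square_integrable_oracle.intro square_integrable_oracle_axioms.intro FF)
    show "integrable D (\<lambda>\<xi>. (norm (FF y \<xi>))\<^sup>2)" for y
      unfolding D uniform_count_measure_def by (rule integrable_point_measure_finite) fact
    show "F y = (LINT \<xi>|D. FF y \<xi>)" for y
      unfolding D uniform_count_measure_def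
      by (subst lebesgue_integral_point_measure_finite) (simp_all add: I F scaleR_sum_right)
  qed unfold_locales
next
  assume *: "expectation_setting D FF F \<sigma>"
  then interpret prob_space D unfolding expectation_setting_def by auto
  have int: "integrable D (FF y)" and F: "F y = (LINT \<xi>|D. FF y \<xi>)"
    and sq: "integrable D (\<lambda>\<xi>. (norm (FF y \<xi> - F y))\<^sup>2)" for y
    using * unfolding expectation_setting_def by auto
  show ?thesis
  proof (intro square_integrable_oracle.intro square_integrable_oracle_axioms.intro FF F)
    fix y
    have "(norm (FF y \<xi>))\<^sup>2 = (norm (FF y \<xi> - F y))\<^sup>2 + 2 * (F y \<bullet> FF y \<xi>) - (norm (F y))\<^sup>2" for \<xi>
      by (simp add: power2_norm_eq_inner inner_diff_left inner_diff_right inner_commute)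
    then show "integrable D (\<lambda>\<xi>. (norm (FF y \<xi>))\<^sup>2)"
      using int[of y] sq[of y] by simp
  qed unfold_locales
qed

section \<open>One iteration of the method\<close>

text \<open>
  The sampling model alone.  The anchor value is a parameter of the individual lemmas instead, because
  the noise and the recursion are the same for full batches and for mega-batches.
\<close>

locale lsvrg = prob_space M + sampling: square_integrable_oracle D FF F
  for M :: "'w measure" and D :: "'s measure"
    and FF :: "real ^ 'p \<Rightarrow> 's \<Rightarrow> real ^ 'p" and F :: "real ^ 'p \<Rightarrow> real ^ 'p" +
  fixes G :: "nat \<Rightarrow> 'w measure"
    and x :: "nat \<Rightarrow> 'w \<Rightarrow> real ^ 'p"
    and coin :: "nat \<Rightarrow> 'w \<Rightarrow> bool"
    and S Sbar :: "nat \<Rightarrow> 'w \<Rightarrow> nat \<Rightarrow> 's"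
    and b n :: "nat \<Rightarrow> nat" and p :: "nat \<Rightarrow> real"
  assumes batch_pos: "1 \<le> b k" and batch_mono: "b k \<le> b (Suc k)"
    and prob_pos: "0 < p k" and prob_less: "p k < 1"
    and history: "history M D b n x coin S Sbar G"
    and fresh: "fresh_draws M D b n p coin S Sbar G"
begin

abbreviation anch :: "nat \<Rightarrow> 'w \<Rightarrow> real ^ 'p" where
  "anch \<equiv> anchor coin x"

abbreviation Dh :: "nat \<Rightarrow> 'w \<Rightarrow> real" where
  "Dh \<equiv> Delta_hat D FF b coin x"

abbreviation batches :: "nat \<Rightarrow> (nat \<Rightarrow> 's) measure" where
  "batches k \<equiv> Pi\<^sub>M {..<b k} (\<lambda>_. D)"

abbreviation mega_law :: "nat \<Rightarrow> (nat \<Rightarrow> 's) measure" where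
  "mega_law k \<equiv> distr M (Pi\<^sub>M {..<n k} (\<lambda>_. D)) (Sbar k)"

text \<open>The part of the estimation error caused by the mini-batch.\<close>

definition noise :: "nat \<Rightarrow> 'w \<Rightarrow> real ^ 'p" where
  "noise k \<omega> = batch_mean FF (b k) (S k \<omega>) (x k \<omega>) - batch_mean FF (b k) (S k \<omega>) (anch k \<omega>)
     - (F (x k \<omega>) - F (anch k \<omega>))"

lemma subalgebra_G: "subalgebra M (G k)"
  using history by (simp add: history_def)

lemma subalgebra_G_Suc: "subalgebra (G (Suc k)) (G k)"
  using history by (simp add: history_def subalgebra_def)

lemma x_measurable_G [measurable]: "x k \<in> borel_measurable (G k)"
  using history by (simp add: history_def)

lemma draws_measurable_G:
  "draws coin S Sbar k \<in> measurable (G (Suc k)) (draw_space D b n k)"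
  using history by (simp add: history_def)

lemma draws_measurable [measurable]: "draws coin S Sbar k \<in> measurable M (draw_space D b n k)"
  by (rule measurable_from_subalg[OF subalgebra_G draws_measurable_G])

lemma coin_measurable_G: "coin k \<in> measurable (G (Suc k)) (count_space UNIV)"
  using measurable_compose[OF draws_measurable_G[unfolded draw_space_def] measurable_fst]
  by (simp add: draws_def)

lemma S_measurable [measurable]: "S k \<in> measurable M (batches k)"
  using measurable_compose[OF measurable_compose[OF draws_measurable[unfolded draw_space_def]
      measurable_snd] measurable_fst]
  by (simp add: draws_def)

lemma Sbar_measurable [measurable]: "Sbar k \<in> measurable M (Pi\<^sub>M {..<n k} (\<lambda>_. D))"
  using measurable_compose[OF measurable_compose[OF draws_measurable[unfolded draw_space_def]
      measurable_snd] measurable_snd]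
  by (simp add: draws_def)

text \<open>
  At \<open>k = 0\<close> truncated subtraction makes both branches equal to \<open>x 0\<close>, so the two-branch formula
  covers all iterations uniformly.
\<close>

lemma anchor_cases:
  "anch k \<omega> = (if coin k \<omega> then x (k - 1) \<omega> else anch (k - 1) \<omega>)"
  by (cases k) simp_all

lemma anchor_measurable_G: "anch k \<in> borel_measurable (G (Suc k))"
proof (induction k)
  case 0
  have "x 0 \<in> borel_measurable (G (Suc 0))"
    by (rule measurable_from_subalg[OF subalgebra_G_Suc x_measurable_G])
  then show ?case by simp
next
  case (Suc k)
  have [measurable]: "x k \<in> borel_measurable (G (Suc (Suc k)))"
    by (intro measurable_from_subalg[OF subalgebra_G_Suc] x_measurable_G)
  have [measurable]: "anch k \<in> borel_measurable (G (Suc (Suc k)))"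
    by (rule measurable_from_subalg[OF subalgebra_G_Suc Suc.IH])
  note coin_measurable_G [measurable]
  show ?case by simp
qed

text \<open>
  The anchor at \<open>k\<close> needs the coin of iteration \<open>k\<close> and is known only from \<open>G (Suc k)\<close> on; both of its
  candidates are already known in \<open>G k\<close>.
\<close>

lemma previous_anchor_measurable_G [measurable]: "anch (k - 1) \<in> borel_measurable (G k)"
proof (cases k)
  case 0
  have "anch 0 = x 0" by (rule ext) simp
  then show ?thesis using x_measurable_G[of 0] 0 by simp
next
  case (Suc j)
  then show ?thesis using anchor_measurable_G[of j] by simp
qed

lemma previous_x_measurable_G [measurable]: "x (k - 1) \<in> borel_measurable (G k)"
proof (cases k)
  case 0
  then show ?thesis using x_measurable_G[of 0] by simp
next
  case (Suc j)
  then show ?thesis using measurable_from_subalg[OF subalgebra_G_Suc x_measurable_G, of j] by simp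
qed

lemma x_measurable [measurable]: "x k \<in> borel_measurable M"
  by (rule measurable_from_subalg[OF subalgebra_G x_measurable_G])

lemma anchor_measurable [measurable]: "anch k \<in> borel_measurable M"
  by (rule measurable_from_subalg[OF subalgebra_G anchor_measurable_G])

lemma Dh_measurable [measurable]: "Dh k \<in> borel_measurable M"
  unfolding Delta_hat_def by measurable

lemma Dh_nonneg: "0 \<le> Dh k \<omega>"
  by (simp add: Delta_hat_def sampling.mean_sq_diff_nonneg)

lemma noise_measurable [measurable]: "noise k \<in> borel_measurable M"
  unfolding noise_def by measurable

lemma prob_space_mega_law: "prob_space (mega_law k)"
  by (rule prob_space_distr) measurable

lemma prob_space_batches: "prob_space (batches k)"
  by (rule prob_space_PiM) unfold_locales

sublocale filtration: finite_measure_subalgebra M "G k" for k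
  by unfold_locales (rule subalgebra_G)

section \<open>Conditional expectations given the history\<close>

text \<open>
  The freezing rule specialised to the product law of the draws: the coin contributes a two-term
  mixture, the batches iterated integrals.
\<close>

lemma cond_exp_draws:
  assumes f: "f \<in> borel_measurable (G k \<Otimes>\<^sub>M draw_space D b n k)"
  shows "AE \<omega> in M. nn_cond_exp M (G k) (\<lambda>\<omega>. f (\<omega>, draws coin S Sbar k \<omega>)) \<omega>
    = ennreal (p k) * (\<integral>\<^sup>+s. \<integral>\<^sup>+s'. f (\<omega>, True, s, s') \<partial>mega_law k \<partial>batches k)
      + ennreal (1 - p k) * (\<integral>\<^sup>+s. \<integral>\<^sup>+s'. f (\<omega>, False, s, s') \<partial>mega_law k \<partial>batches k)"
proof -
  interpret Q: prob_space "mega_law k" by (rule prob_space_mega_law)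
  interpret P: prob_space "batches k" by (rule prob_space_batches)
  interpret PQ: pair_prob_space "batches k" "mega_law k" ..
  have sets: "sets (draw_space D b n k)
      = sets (measure_pmf (bernoulli_pmf (p k)) \<Otimes>\<^sub>M (batches k \<Otimes>\<^sub>M mega_law k))"
    unfolding draw_space_def by (intro sets_pair_measure_cong) simp_all
  have indep: "indep_set (sets (G k))
      {draws coin S Sbar k -` A \<inter> space M | A. A \<in> sets (draw_space D b n k)}"
    and law: "distr M (draw_space D b n k) (draws coin S Sbar k)
      = measure_pmf (bernoulli_pmf (p k)) \<Otimes>\<^sub>M (batches k \<Otimes>\<^sub>M mega_law k)"
    using fresh by (simp_all add: fresh_draws_def)
  have expand: "(\<integral>\<^sup>+t. f (\<omega>, t) \<partial>distr M (draw_space D b n k) (draws coin S Sbar k))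
      = ennreal (p k) * (\<integral>\<^sup>+s. \<integral>\<^sup>+s'. f (\<omega>, True, s, s') \<partial>mega_law k \<partial>batches k)
      + ennreal (1 - p k) * (\<integral>\<^sup>+s. \<integral>\<^sup>+s'. f (\<omega>, False, s, s') \<partial>mega_law k \<partial>batches k)"
    if "\<omega> \<in> space M" for \<omega>
  proof -
    have \<omega>: "\<omega> \<in> space (G k)" using that subalgebra_G[of k] by (simp add: subalgebra_def)
    have f\<omega>: "(\<lambda>t. f (\<omega>, t)) \<in> borel_measurable
        (measure_pmf (bernoulli_pmf (p k)) \<Otimes>\<^sub>M (batches k \<Otimes>\<^sub>M mega_law k))"
      using measurable_compose[OF measurable_Pair1'[OF \<omega>] f] by (simp add: measurable_cong_sets[OF sets refl])
    have fc: "(\<lambda>u. f (\<omega>, c, u)) \<in> borel_measurable (batches k \<Otimes>\<^sub>M mega_law k)" for c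
      by (rule measurable_compose[OF measurable_Pair1' f\<omega>]) simp
    have "(\<integral>\<^sup>+u. f (\<omega>, c, u) \<partial>(batches k \<Otimes>\<^sub>M mega_law k))
        = (\<integral>\<^sup>+s. \<integral>\<^sup>+s'. f (\<omega>, c, s, s') \<partial>mega_law k \<partial>batches k)" for c
      by (rule Q.nn_integral_fst[symmetric, OF fc])
    then show ?thesis
      unfolding law using prob_pos[of k] prob_less[of k]
      by (subst PQ.P.nn_integral_fst[symmetric, OF f\<omega>]) (simp add: mult.commute)
  qed
  have "AE \<omega> in M. nn_cond_exp M (G k) (\<lambda>\<omega>. f (\<omega>, draws coin S Sbar k \<omega>)) \<omega>
      = (\<integral>\<^sup>+t. f (\<omega>, t) \<partial>distr M (draw_space D b n k) (draws coin S Sbar k))"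
    by (rule nn_cond_exp_independent_argument[OF subalgebra_G draws_measurable indep f])
  then show ?thesis
    by (rule AE_mp) (simp add: expand)
qed

lemma cond_exp_Dh:
  "AE \<omega> in M. cond_E M (G k) (Dh k) \<omega>
    = ennreal (p k * (1 / real (b k) * mean_sq_diff D FF (x k \<omega>) (x (k - 1) \<omega>))
        + (1 - p k) * (1 / real (b k) * mean_sq_diff D FF (x k \<omega>) (anch (k - 1) \<omega>)))"
proof -
  interpret Q: prob_space "mega_law k" by (rule prob_space_mega_law)
  interpret P: prob_space "batches k" by (rule prob_space_batches)
  let ?f = "\<lambda>(\<omega>, c, u). ennreal (1 / real (b k)
    * mean_sq_diff D FF (x k \<omega>) (if c then x (k - 1) \<omega> else anch (k - 1) \<omega>))"
  have f: "?f \<in> borel_measurable (G k \<Otimes>\<^sub>M draw_space D b n k)"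
    unfolding draw_space_def by measurable
  have "(\<lambda>\<omega>. ennreal (Dh k \<omega>)) = (\<lambda>\<omega>. ?f (\<omega>, draws coin S Sbar k \<omega>))"
    by (simp add: Delta_hat_def anchor_cases[of k] draws_def fun_eq_iff)
  then show ?thesis
    using cond_exp_draws[OF f] prob_pos[of k] prob_less[of k]
    by (simp add: P.emeasure_space_1 Q.emeasure_space_1[simplified] sampling.mean_sq_diff_nonneg
        flip: ennreal_mult ennreal_plus)
qed

text \<open>
  The coin and the mini-batch are independent, so the variance bound for fixed points applies on each
  branch of the mixture with the same weights that occur in \<open>cond_exp_Dh\<close>.
\<close>

lemma cond_exp_noise:
  "AE \<omega> in M. cond_E M (G k) (\<lambda>\<omega>. (norm (noise k \<omega>))\<^sup>2) \<omega> \<le> cond_E M (G k) (Dh k) \<omega>"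
proof -
  interpret Q: prob_space "mega_law k" by (rule prob_space_mega_law)
  define N where "N y z s = ennreal ((norm (batch_mean FF (b k) s y - batch_mean FF (b k) s z
    - (F y - F z)))\<^sup>2)" for y z s
  let ?f = "\<lambda>(\<omega>, c, s, s'). N (x k \<omega>) (if c then x (k - 1) \<omega> else anch (k - 1) \<omega>) s"
  have f: "?f \<in> borel_measurable (G k \<Otimes>\<^sub>M draw_space D b n k)"
    unfolding draw_space_def N_def by measurable
  have "(\<lambda>\<omega>. ennreal ((norm (noise k \<omega>))\<^sup>2)) = (\<lambda>\<omega>. ?f (\<omega>, draws coin S Sbar k \<omega>))"
    by (simp add: noise_def anchor_cases[of k] draws_def N_def fun_eq_iff)
  then have noise: "AE \<omega> in M. cond_E M (G k) (\<lambda>\<omega>. (norm (noise k \<omega>))\<^sup>2) \<omega>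
      = ennreal (p k) * (\<integral>\<^sup>+s. N (x k \<omega>) (x (k - 1) \<omega>) s \<partial>batches k)
        + ennreal (1 - p k) * (\<integral>\<^sup>+s. N (x k \<omega>) (anch (k - 1) \<omega>) s \<partial>batches k)"
    using cond_exp_draws[OF f] by (simp add: Q.emeasure_space_1[simplified])
  show ?thesis
    using noise cond_exp_Dh[of k]
  proof eventually_elim
    case (elim \<omega>)
    have "cond_E M (G k) (\<lambda>\<omega>. (norm (noise k \<omega>))\<^sup>2) \<omega>
        \<le> ennreal (p k) * ennreal (1 / real (b k) * mean_sq_diff D FF (x k \<omega>) (x (k - 1) \<omega>))
        + ennreal (1 - p k) * ennreal (1 / real (b k) * mean_sq_diff D FF (x k \<omega>) (anch (k - 1) \<omega>))"
      unfolding elim(1) N_def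
      by (intro add_mono mult_left_mono sampling.batch_difference_variance batch_pos) simp_all
    also have "\<dots> = cond_E M (G k) (Dh k) \<omega>"
      unfolding elim(2) using prob_pos[of k] prob_less[of k]
      by (simp add: sampling.mean_sq_diff_nonneg flip: ennreal_mult ennreal_plus)
    finally show ?case .
  qed
qed

text \<open>
  The assumption bounds the mega-batch error with the anchor frozen, although the anchor depends on
  the coin of the same iteration.  As the mega-batch is independent of that coin, the squared error
  and its frozen mean \<open>\<phi>\<close> at the random anchor have the same conditional expectation, and the
  assumption bounds \<open>\<phi>\<close> at the random anchor almost surely.
\<close>

lemma cond_exp_anchor_error:
  assumes mega: "AE \<omega> in M.
      integrable M (\<lambda>\<omega>'. (norm (batch_mean FF (n k) (Sbar k \<omega>') (anch k \<omega>) - F (anch k \<omega>)))\<^sup>2) \<and>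
      (LINT \<omega>'|M. (norm (batch_mean FF (n k) (Sbar k \<omega>') (anch k \<omega>) - F (anch k \<omega>)))\<^sup>2) \<le> v"
  shows "AE \<omega> in M. cond_E M (G k)
    (\<lambda>\<omega>. (norm (batch_mean FF (n k) (Sbar k \<omega>) (anch k \<omega>) - F (anch k \<omega>)))\<^sup>2) \<omega> \<le> ennreal v"
proof -
  interpret Q: prob_space "mega_law k" by (rule prob_space_mega_law)
  interpret P: prob_space "batches k" by (rule prob_space_batches)
  define N where "N y s = ennreal ((norm (batch_mean FF (n k) s y - F y))\<^sup>2)" for y s
  define \<phi> where "\<phi> y = (\<integral>\<^sup>+s. N y s \<partial>mega_law k)" for y
  have [measurable]: "(\<lambda>w. N (f w) (g w)) \<in> borel_measurable A"
    if [measurable]: "f \<in> borel_measurable A" "g \<in> measurable A (Pi\<^sub>M {..<n k} (\<lambda>_. D))" for f g and A :: "'z measure"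
    unfolding N_def by measurable
  have \<phi> [measurable]: "\<phi> \<in> borel_measurable borel"
    unfolding \<phi>_def[abs_def] N_def by measurable
  let ?f = "\<lambda>(\<omega>, c, s, s'). N (if c then x (k - 1) \<omega> else anch (k - 1) \<omega>) s'"
  let ?g = "\<lambda>(\<omega>, c, u). \<phi> (if c then x (k - 1) \<omega> else anch (k - 1) \<omega>)"
  have f: "?f \<in> borel_measurable (G k \<Otimes>\<^sub>M draw_space D b n k)"
    unfolding draw_space_def N_def by measurable
  have g: "?g \<in> borel_measurable (G k \<Otimes>\<^sub>M draw_space D b n k)"
    unfolding draw_space_def by measurable
  have fe: "(\<lambda>\<omega>. ennreal ((norm (batch_mean FF (n k) (Sbar k \<omega>) (anch k \<omega>) - F (anch k \<omega>)))\<^sup>2))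
      = (\<lambda>\<omega>. ?f (\<omega>, draws coin S Sbar k \<omega>))"
    by (simp add: anchor_cases[of k] draws_def N_def fun_eq_iff)
  have ge: "(\<lambda>\<omega>. \<phi> (anch k \<omega>)) = (\<lambda>\<omega>. ?g (\<omega>, draws coin S Sbar k \<omega>))"
    by (simp add: anchor_cases[of k] draws_def fun_eq_iff)
  have frozen: "AE \<omega> in M. cond_E M (G k)
      (\<lambda>\<omega>. (norm (batch_mean FF (n k) (Sbar k \<omega>) (anch k \<omega>) - F (anch k \<omega>)))\<^sup>2) \<omega>
      = nn_cond_exp M (G k) (\<lambda>\<omega>. \<phi> (anch k \<omega>)) \<omega>"
    using cond_exp_draws[OF f] cond_exp_draws[OF g] unfolding fe ge
    by eventually_elim (simp add: \<phi>_def P.emeasure_space_1 Q.emeasure_space_1[simplified])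
  have "AE \<omega> in M. \<phi> (anch k \<omega>) \<le> ennreal v"
    using mega
  proof eventually_elim
    case (elim \<omega>)
    have "\<phi> (anch k \<omega>) = (\<integral>\<^sup>+\<omega>'. N (anch k \<omega>) (Sbar k \<omega>') \<partial>M)"
      unfolding \<phi>_def N_def by (rule nn_integral_distr) measurable
    also have "\<dots> = ennreal (LINT \<omega>'|M. (norm (batch_mean FF (n k) (Sbar k \<omega>') (anch k \<omega>)
        - F (anch k \<omega>)))\<^sup>2)"
      unfolding N_def using elim by (intro nn_integral_eq_integral) simp_all
    also have "\<dots> \<le> ennreal v" using elim by (intro ennreal_leI) simp
    finally show ?case .
  qed
  then have "AE \<omega> in M. nn_cond_exp M (G k) (\<lambda>\<omega>. \<phi> (anch k \<omega>)) \<omega>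
      \<le> nn_cond_exp M (G k) (\<lambda>\<omega>. ennreal v) \<omega>"
    by (rule filtration.nn_cond_exp_mono) measurable
  moreover have "AE \<omega> in M. ennreal v = nn_cond_exp M (G k) (\<lambda>\<omega>. ennreal v) \<omega>"
    by (rule filtration.nn_cond_exp_F_meas) simp
  ultimately show ?thesis
    using frozen by eventually_elim simp
qed

section \<open>The recursion and the error bound\<close>

text \<open>
  With probability \<open>p k\<close> the new distance is just the step \<open>E_bar\<close>; otherwise Young's inequality
  bounds it by \<open>1 + \<tau>\<close> times the old distance plus \<open>(1 + \<tau>) / \<tau>\<close> times the step.  Monotone batch
  sizes allow the old distance to keep its normalisation \<open>1 / b (k - 1)\<close>.
\<close>

lemma cond_exp_Dh_recursion:
  assumes \<alpha>: "0 < \<alpha>" "\<alpha> < 1"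
  shows "AE \<omega> in M. cond_E M (G k) (Dh k) \<omega>
    \<le> ennreal ((1 - \<alpha> * p k) * prev 0 Dh k \<omega>
        + 1 / ((1 - \<alpha>) * real (b k) * p k) * E_bar D FF x k \<omega>)"
  using cond_exp_Dh[of k]
proof eventually_elim
  case (elim \<omega>)
  show ?case
  proof (cases k)
    case 0
    then show ?thesis unfolding elim by (simp add: prev_def E_bar_def)
  next
    case (Suc j)
    let ?m = "mean_sq_diff D FF"
    let ?q = "p k" and ?B = "real (b k)"
    let ?new = "?m (x k \<omega>) (x j \<omega>)" and ?old = "?m (x j \<omega>) (anch j \<omega>)"
    \<comment> \<open>The solution of \<open>(1 - p k) * (1 + \<tau>) = 1 - \<alpha> * p k\<close>, the prescribed contraction factor.\<close>
    define \<tau> where "\<tau> = (1 - \<alpha>) * ?q / (1 - ?q)"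
    have q: "0 < ?q" "?q < 1" by (rule prob_pos, rule prob_less)
    have B: "0 < ?B" using batch_pos[of k] by simp
    have \<tau>: "0 < \<tau>" using q \<alpha> by (simp add: \<tau>_def)
    have c1: "(1 - ?q) * (1 + \<tau>) = 1 - \<alpha> * ?q"
      using q by (simp add: \<tau>_def field_simps)
    have "\<alpha> * ?q < 1" using q \<alpha> mult_strict_mono[of \<alpha> 1 ?q 1] by simp
    \<comment> \<open>The total weight of the step; the bound amounts to \<open>p k \<le> 1 + \<alpha>\<close>.\<close>
    have "(1 - ?q) * ((1 + \<tau>) / \<tau>) = (1 - \<alpha> * ?q) / \<tau>"
      unfolding c1[symmetric] by simp
    then have "?q + (1 - ?q) * ((1 + \<tau>) / \<tau>) = ?q + (1 - \<alpha> * ?q) * (1 - ?q) / ((1 - \<alpha>) * ?q)"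
      by (simp add: \<tau>_def)
    also have "\<dots> = (1 - ?q * (1 + \<alpha> - ?q)) / ((1 - \<alpha>) * ?q)"
      using q \<alpha> by (simp add: field_simps)
    also have "\<dots> \<le> 1 / ((1 - \<alpha>) * ?q)"
      using q \<alpha> by (intro divide_right_mono) simp_all
    finally have c2: "?q + (1 - ?q) * ((1 + \<tau>) / \<tau>) \<le> 1 / ((1 - \<alpha>) * ?q)" .
    have nn: "0 \<le> ?new" "0 \<le> ?old" by (rule sampling.mean_sq_diff_nonneg)+
    have "?q * ?new + (1 - ?q) * ?m (x k \<omega>) (anch j \<omega>)
        \<le> ?q * ?new + (1 - ?q) * ((1 + \<tau>) * ?old + ((1 + \<tau>) / \<tau>) * ?new)"
      using q by (intro add_left_mono mult_left_mono sampling.mean_sq_diff_le_Young \<tau>) simp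
    also have "\<dots> = ((1 - ?q) * (1 + \<tau>)) * ?old + (?q + (1 - ?q) * ((1 + \<tau>) / \<tau>)) * ?new"
      by (simp only: ring_distribs ac_simps)
    also have "\<dots> \<le> (1 - \<alpha> * ?q) * ?old + 1 / ((1 - \<alpha>) * ?q) * ?new"
      unfolding c1 by (intro add_left_mono mult_right_mono c2 nn)
    finally have "(?q * ?new + (1 - ?q) * ?m (x k \<omega>) (anch j \<omega>)) / ?B
        \<le> ((1 - \<alpha> * ?q) * ?old + 1 / ((1 - \<alpha>) * ?q) * ?new) / ?B"
      using B by (intro divide_right_mono) simp_all
    also have "\<dots> = (1 - \<alpha> * ?q) * (?old / ?B) + 1 / ((1 - \<alpha>) * ?B * ?q) * ?new"
      by (simp add: add_divide_distrib ac_simps)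
    also have "\<dots> \<le> (1 - \<alpha> * ?q) * (?old / real (b j)) + 1 / ((1 - \<alpha>) * ?B * ?q) * ?new"
      using \<open>\<alpha> * ?q < 1\<close> nn batch_pos[of j] batch_mono[of j] Suc
      by (intro add_right_mono mult_left_mono divide_left_mono) simp_all
    finally have "(?q * ?new + (1 - ?q) * ?m (x k \<omega>) (anch j \<omega>)) / ?B
        \<le> (1 - \<alpha> * ?q) * prev 0 Dh k \<omega> + 1 / ((1 - \<alpha>) * ?B * ?q) * E_bar D FF x k \<omega>"
      using Suc by (simp add: prev_def E_bar_def Delta_hat_def)
    then show ?thesis
      unfolding elim using Suc by (intro ennreal_leI) (simp add: add_divide_distrib)
  qed
qed

lemma cond_exp_affine:
  assumes [measurable]: "f \<in> borel_measurable M" and "\<And>\<omega>. 0 \<le> f \<omega>" "0 \<le> a" "0 \<le> c"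
  shows "AE \<omega> in M. cond_E M (G k) (\<lambda>\<omega>. a * f \<omega> + c) \<omega> = ennreal a * cond_E M (G k) f \<omega> + ennreal c"
proof -
  have eq: "ennreal (a * f \<omega> + c) = ennreal a * ennreal (f \<omega>) + ennreal c" for \<omega>
    using assms by (simp add: ennreal_mult)
  have "AE \<omega> in M. nn_cond_exp M (G k) (\<lambda>\<omega>. ennreal a * ennreal (f \<omega>)) \<omega>
      + nn_cond_exp M (G k) (\<lambda>\<omega>. ennreal c) \<omega> = cond_E M (G k) (\<lambda>\<omega>. a * f \<omega> + c) \<omega>"
    unfolding eq by (rule filtration.nn_cond_exp_sum) measurable
  moreover have "AE \<omega> in M. ennreal a * cond_E M (G k) f \<omega>
      = nn_cond_exp M (G k) (\<lambda>\<omega>. ennreal a * ennreal (f \<omega>)) \<omega>"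
    by (rule filtration.nn_cond_exp_prod) measurable
  moreover have "AE \<omega> in M. ennreal c = nn_cond_exp M (G k) (\<lambda>\<omega>. ennreal c) \<omega>"
    by (rule filtration.nn_cond_exp_F_meas) simp
  ultimately show ?thesis by eventually_elim simp
qed

lemma cond_exp_add:
  assumes [measurable]: "f \<in> borel_measurable M" "g \<in> borel_measurable M"
    and "\<And>\<omega>. 0 \<le> f \<omega>" "\<And>\<omega>. 0 \<le> g \<omega>"
  shows "AE \<omega> in M. cond_E M (G k) (\<lambda>\<omega>. f \<omega> + g \<omega>) \<omega> = cond_E M (G k) f \<omega> + cond_E M (G k) g \<omega>"
proof -
  have "AE \<omega> in M. cond_E M (G k) f \<omega> + cond_E M (G k) g \<omega>
      = nn_cond_exp M (G k) (\<lambda>\<omega>. ennreal (f \<omega>) + ennreal (g \<omega>)) \<omega>"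
    by (rule filtration.nn_cond_exp_sum) measurable
  then show ?thesis by eventually_elim (simp add: assms)
qed

lemma estimator_error:
  "lsvrg_estimator FF b coin S Fbar x k \<omega> - F (x k \<omega>) = noise k \<omega> + (Fbar k \<omega> - F (anch k \<omega>))"
  by (simp add: lsvrg_estimator_def noise_def)

lemma cond_exp_estimator:
  assumes [measurable]: "Fbar k \<in> borel_measurable M" and \<tau>: "0 < \<tau>"
  shows "AE \<omega> in M.
    cond_E M (G k) (\<lambda>\<omega>. (norm (lsvrg_estimator FF b coin S Fbar x k \<omega> - F (x k \<omega>)))\<^sup>2) \<omega>
      \<le> ennreal (1 + \<tau>) * cond_E M (G k) (Dh k) \<omega>
        + ennreal ((1 + \<tau>) / \<tau>) * cond_E M (G k) (\<lambda>\<omega>. (norm (Fbar k \<omega> - F (anch k \<omega>)))\<^sup>2) \<omega>"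
proof -
  let ?e = "\<lambda>\<omega>. (norm (Fbar k \<omega> - F (anch k \<omega>)))\<^sup>2" and ?N = "\<lambda>\<omega>. (norm (noise k \<omega>))\<^sup>2"
  have "AE \<omega> in M. cond_E M (G k) (\<lambda>\<omega>. (norm (noise k \<omega> + (Fbar k \<omega> - F (anch k \<omega>))))\<^sup>2) \<omega>
      \<le> cond_E M (G k) (\<lambda>\<omega>. (1 + \<tau>) * ?N \<omega> + ((1 + \<tau>) / \<tau>) * ?e \<omega>) \<omega>"
    by (rule filtration.nn_cond_exp_mono) (intro AE_I2 ennreal_leI norm_add_power2_le_Young \<tau>, measurable)
  moreover have "AE \<omega> in M. cond_E M (G k) (\<lambda>\<omega>. (1 + \<tau>) * ?N \<omega> + ((1 + \<tau>) / \<tau>) * ?e \<omega>) \<omega>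
      = cond_E M (G k) (\<lambda>\<omega>. (1 + \<tau>) * ?N \<omega>) \<omega> + cond_E M (G k) (\<lambda>\<omega>. ((1 + \<tau>) / \<tau>) * ?e \<omega>) \<omega>"
    using \<tau> by (intro cond_exp_add) simp_all
  moreover have "AE \<omega> in M. cond_E M (G k) (\<lambda>\<omega>. (1 + \<tau>) * ?N \<omega>) \<omega>
      = ennreal (1 + \<tau>) * cond_E M (G k) ?N \<omega>"
    using cond_exp_affine[of ?N "1 + \<tau>" 0 k] \<tau> by simp
  moreover have "AE \<omega> in M. cond_E M (G k) (\<lambda>\<omega>. ((1 + \<tau>) / \<tau>) * ?e \<omega>) \<omega>
      = ennreal ((1 + \<tau>) / \<tau>) * cond_E M (G k) ?e \<omega>"
    using cond_exp_affine[of ?e "(1 + \<tau>) / \<tau>" 0 k] \<tau> by simp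
  ultimately show ?thesis
    using cond_exp_noise[of k] unfolding estimator_error
  proof eventually_elim
    case (elim \<omega>)
    show ?case
      using elim(1) unfolding elim(2,3,4)
      by (rule order_trans) (intro add_right_mono mult_left_mono elim(5), simp)
  qed
qed

text \<open>
  Conditional expectations of functions that are not measurable are zero by convention, so the
  measurability of the anchor value is what gives the bounds their meaning.
\<close>

lemma anchor_value_measurable:
  assumes "full_batch M F coin x Fbar \<or> mega_batch M FF F n \<sigma> coin Sbar x Fbar"
  shows "Fbar k \<in> borel_measurable M"
  using assms
proof
  assume "full_batch M F coin x Fbar"
  then have "Fbar k \<omega> = F (anch k \<omega>)" if "\<omega> \<in> space M" for \<omega>
    using that unfolding full_batch_def by blast
  then show ?thesis by (subst measurable_cong) (assumption, measurable)
next
  assume "mega_batch M FF F n \<sigma> coin Sbar x Fbar"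
  then have "Fbar k \<omega> = batch_mean FF (n k) (Sbar k \<omega>) (anch k \<omega>)" if "\<omega> \<in> space M" for \<omega>
    using that unfolding mega_batch_def by blast
  then show ?thesis by (subst measurable_cong) (assumption, measurable)
qed

lemma cond_exp_anchor_value_error:
  assumes Fbar: "full_batch M F coin x Fbar \<or> mega_batch M FF F n \<sigma> coin Sbar x Fbar"
  shows "AE \<omega> in M. cond_E M (G k) (\<lambda>\<omega>. (norm (Fbar k \<omega> - F (anch k \<omega>)))\<^sup>2) \<omega> \<le> ennreal (\<sigma>\<^sup>2 / real (n k))"
proof -
  note anchor_value_measurable[OF Fbar, measurable]
  show ?thesis
    using Fbar
  proof
    assume full: "full_batch M F coin x Fbar"
    have "Fbar k \<omega> = F (anch k \<omega>)" if "\<omega> \<in> space M" for \<omega>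
      using full that unfolding full_batch_def by blast
    then have "AE \<omega> in M. cond_E M (G k) (\<lambda>\<omega>. (norm (Fbar k \<omega> - F (anch k \<omega>)))\<^sup>2) \<omega>
        = nn_cond_exp M (G k) (\<lambda>_. 0) \<omega>"
      by (intro filtration.nn_cond_exp_cong AE_I2) simp_all
    moreover have "AE \<omega> in M. 0 = nn_cond_exp M (G k) (\<lambda>\<omega>. 0) \<omega>"
      by (rule filtration.nn_cond_exp_F_meas) simp
    ultimately show ?thesis by eventually_elim simp
  next
    assume mega: "mega_batch M FF F n \<sigma> coin Sbar x Fbar"
    have "Fbar k \<omega> = batch_mean FF (n k) (Sbar k \<omega>) (anch k \<omega>)" if "\<omega> \<in> space M" for \<omega>
      using mega that unfolding mega_batch_def by blast
    then have "AE \<omega> in M. cond_E M (G k) (\<lambda>\<omega>. (norm (Fbar k \<omega> - F (anch k \<omega>)))\<^sup>2) \<omega>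
        = cond_E M (G k) (\<lambda>\<omega>. (norm (batch_mean FF (n k) (Sbar k \<omega>) (anch k \<omega>) - F (anch k \<omega>)))\<^sup>2) \<omega>"
      by (intro filtration.nn_cond_exp_cong AE_I2) simp_all
    moreover have "AE \<omega> in M. cond_E M (G k)
        (\<lambda>\<omega>. (norm (batch_mean FF (n k) (Sbar k \<omega>) (anch k \<omega>) - F (anch k \<omega>)))\<^sup>2) \<omega>
        \<le> ennreal (\<sigma>\<^sup>2 / real (n k))"
    proof (rule cond_exp_anchor_error)
      show "AE \<omega> in M.
        integrable M (\<lambda>\<omega>'. (norm (batch_mean FF (n k) (Sbar k \<omega>') (anch k \<omega>) - F (anch k \<omega>)))\<^sup>2) \<and>
        (LINT \<omega>'|M. (norm (batch_mean FF (n k) (Sbar k \<omega>') (anch k \<omega>) - F (anch k \<omega>)))\<^sup>2)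
          \<le> \<sigma>\<^sup>2 / real (n k)"
        using mega[unfolded mega_batch_def, THEN conjunct2, rule_format, of k]
        by eventually_elim blast
    qed
    ultimately show ?thesis by eventually_elim simp
  qed
qed

section \<open>The variance reduction properties\<close>

lemma VR_parameters:
  assumes "0 < \<alpha>" "\<alpha> < 1" "0 \<le> c"
  shows "0 < \<alpha> * p k" "\<alpha> * p k \<le> 1" "0 \<le> c / ((1 - \<alpha>) * real (b k) * p k)"
  using assms prob_pos[of k] prob_less[of k] mult_mono[of \<alpha> 1 "p k" 1] by simp_all

text \<open>
  The bound on the second moment is \<open>cond_exp_estimator\<close> with \<open>\<tau> = 1\<close>.  The deterministic part
  \<open>2 * \<sigma>\<^sup>2 / n k\<close> of the error measure must itself satisfy the recursion; this is the assumption
  \<open>budget\<close>, in which the initial value \<open>d\<close> and the noise levels \<open>s\<close> are left open to cover both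
  initialisations.
\<close>

lemma VR_property_anchor_noise:
  assumes Fbar: "full_batch M F coin x Fbar \<or> mega_batch M FF F n \<sigma> coin Sbar x Fbar"
    and \<alpha>: "0 < \<alpha>" "\<alpha> < 1"
    and s: "\<And>k. 0 \<le> s k"
    and budget: "\<And>k. 2 * \<sigma>\<^sup>2 / real (n k)
      \<le> (1 - \<alpha> * p k) * (case k of 0 \<Rightarrow> d | Suc j \<Rightarrow> 2 * \<sigma>\<^sup>2 / real (n j)) + (s k)\<^sup>2"
  shows "VR_property_init d M G F x (E_bar D FF x) (lsvrg_estimator FF b coin S Fbar x)
    (\<lambda>k \<omega>. 2 * Dh k \<omega> + 2 * \<sigma>\<^sup>2 / real (n k)) (\<lambda>k. \<alpha> * p k)
    (\<lambda>k. 2 / ((1 - \<alpha>) * real (b k) * p k)) s"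
  unfolding VR_property_init_def
proof (intro conjI allI ballI)
  let ?\<Delta> = "\<lambda>k \<omega>. 2 * Dh k \<omega> + 2 * \<sigma>\<^sup>2 / real (n k)"
  show "AE \<omega> in M. \<forall>k.
      cond_E M (G k) (\<lambda>\<omega>. (norm (lsvrg_estimator FF b coin S Fbar x k \<omega> - F (x k \<omega>)))\<^sup>2) \<omega>
        \<le> cond_E M (G k) (?\<Delta> k) \<omega> \<and>
      cond_E M (G k) (?\<Delta> k) \<omega> \<le> ennreal ((1 - \<alpha> * p k) * prev d ?\<Delta> k \<omega>
        + 2 / ((1 - \<alpha>) * real (b k) * p k) * E_bar D FF x k \<omega> + (s k)\<^sup>2)"
    unfolding AE_all_countable
  proof
    fix k
    have "AE \<omega> in M. cond_E M (G k) (?\<Delta> k) \<omega>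
        = ennreal 2 * cond_E M (G k) (Dh k) \<omega> + ennreal (2 * \<sigma>\<^sup>2 / real (n k))"
      by (rule cond_exp_affine) (simp_all add: Dh_nonneg)
    then show "AE \<omega> in M.
        cond_E M (G k) (\<lambda>\<omega>. (norm (lsvrg_estimator FF b coin S Fbar x k \<omega> - F (x k \<omega>)))\<^sup>2) \<omega>
          \<le> cond_E M (G k) (?\<Delta> k) \<omega> \<and>
        cond_E M (G k) (?\<Delta> k) \<omega> \<le> ennreal ((1 - \<alpha> * p k) * prev d ?\<Delta> k \<omega>
          + 2 / ((1 - \<alpha>) * real (b k) * p k) * E_bar D FF x k \<omega> + (s k)\<^sup>2)"
      using cond_exp_estimator[of Fbar k 1, OF anchor_value_measurable[OF Fbar] zero_less_one]
        cond_exp_anchor_value_error[OF Fbar, of k] cond_exp_Dh_recursion[OF \<alpha>, of k]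
    proof eventually_elim
      case (elim \<omega>)
      let ?r = "(1 - \<alpha> * p k) * prev 0 Dh k \<omega>
        + 1 / ((1 - \<alpha>) * real (b k) * p k) * E_bar D FF x k \<omega>"
      have "0 \<le> prev 0 Dh k \<omega>" "0 \<le> E_bar D FF x k \<omega>"
        by (auto simp: prev_def E_bar_def Dh_nonneg sampling.mean_sq_diff_nonneg split: nat.split)
      then have r: "0 \<le> ?r"
        using VR_parameters[OF \<alpha>, of 1 k] by (intro add_nonneg_nonneg mult_nonneg_nonneg) simp_all
      have "ennreal 2 * cond_E M (G k) (\<lambda>\<omega>. (norm (Fbar k \<omega> - F (anch k \<omega>)))\<^sup>2) \<omega>
          \<le> ennreal 2 * ennreal (\<sigma>\<^sup>2 / real (n k))"
        by (intro mult_left_mono elim(3)) simp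
      also have "\<dots> = ennreal (2 * \<sigma>\<^sup>2 / real (n k))"
        by (subst ennreal_mult[symmetric]) simp_all
      finally have anchor_part: "ennreal 2 * cond_E M (G k) (\<lambda>\<omega>. (norm (Fbar k \<omega> - F (anch k \<omega>)))\<^sup>2) \<omega>
          \<le> ennreal (2 * \<sigma>\<^sup>2 / real (n k))" .
      have "cond_E M (G k) (\<lambda>\<omega>. (norm (lsvrg_estimator FF b coin S Fbar x k \<omega> - F (x k \<omega>)))\<^sup>2) \<omega>
          \<le> ennreal 2 * cond_E M (G k) (Dh k) \<omega>
            + ennreal 2 * cond_E M (G k) (\<lambda>\<omega>. (norm (Fbar k \<omega> - F (anch k \<omega>)))\<^sup>2) \<omega>"
        using elim(2) by simp
      also have "\<dots> \<le> cond_E M (G k) (?\<Delta> k) \<omega>"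
        unfolding elim(1) by (rule add_left_mono[OF anchor_part])
      finally have estimator: "cond_E M (G k)
          (\<lambda>\<omega>. (norm (lsvrg_estimator FF b coin S Fbar x k \<omega> - F (x k \<omega>)))\<^sup>2) \<omega>
          \<le> cond_E M (G k) (?\<Delta> k) \<omega>" .
      have "cond_E M (G k) (?\<Delta> k) \<omega> \<le> ennreal 2 * ennreal ?r + ennreal (2 * \<sigma>\<^sup>2 / real (n k))"
        unfolding elim(1) by (intro add_right_mono mult_left_mono elim(4)) simp
      also have "\<dots> = ennreal (2 * ?r + 2 * \<sigma>\<^sup>2 / real (n k))"
        using r by (subst ennreal_mult[symmetric], simp, assumption, subst ennreal_plus[symmetric]) simp_all
      also have "\<dots> \<le> ennreal ((1 - \<alpha> * p k) * prev d ?\<Delta> k \<omega>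
          + 2 / ((1 - \<alpha>) * real (b k) * p k) * E_bar D FF x k \<omega> + (s k)\<^sup>2)"
      proof (rule ennreal_leI)
        have "prev d ?\<Delta> k \<omega> = 2 * prev 0 Dh k \<omega> + (case k of 0 \<Rightarrow> d | Suc j \<Rightarrow> 2 * \<sigma>\<^sup>2 / real (n j))"
          by (simp add: prev_def split: nat.split)
        then have "(1 - \<alpha> * p k) * prev d ?\<Delta> k \<omega> = 2 * ((1 - \<alpha> * p k) * prev 0 Dh k \<omega>)
            + (1 - \<alpha> * p k) * (case k of 0 \<Rightarrow> d | Suc j \<Rightarrow> 2 * \<sigma>\<^sup>2 / real (n j))"
          by (simp only: distrib_left mult.left_commute)
        then show "2 * ?r + 2 * \<sigma>\<^sup>2 / real (n k) \<le> (1 - \<alpha> * p k) * prev d ?\<Delta> k \<omega>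
            + 2 / ((1 - \<alpha>) * real (b k) * p k) * E_bar D FF x k \<omega> + (s k)\<^sup>2"
          using budget[of k] by simp
      qed
      finally show ?case using estimator by simp
    qed
  qed
qed (use VR_parameters[OF \<alpha>, of 2] s Dh_nonneg in simp_all)

text \<open>Here the estimation error is exactly the mini-batch noise, so the factor \<open>1 + \<tau>\<close> is not incurred.\<close>

lemma VR_property_full_batch:
  assumes full: "full_batch M F coin x Fbar" and \<alpha>: "0 < \<alpha>" "\<alpha> < 1"
  shows "VR_property M G F x (E_bar D FF x) (lsvrg_estimator FF b coin S Fbar x) Dh
    (\<lambda>k. \<alpha> * p k) (\<lambda>k. 1 / ((1 - \<alpha>) * real (b k) * p k)) (\<lambda>k. 0)"
  unfolding VR_property_init_def
proof (intro conjI allI ballI)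
  show "AE \<omega> in M. \<forall>k.
      cond_E M (G k) (\<lambda>\<omega>. (norm (lsvrg_estimator FF b coin S Fbar x k \<omega> - F (x k \<omega>)))\<^sup>2) \<omega>
        \<le> cond_E M (G k) (Dh k) \<omega> \<and>
      cond_E M (G k) (Dh k) \<omega> \<le> ennreal ((1 - \<alpha> * p k) * prev 0 Dh k \<omega>
        + 1 / ((1 - \<alpha>) * real (b k) * p k) * E_bar D FF x k \<omega> + 0\<^sup>2)"
    unfolding AE_all_countable
  proof
    fix k
    have [measurable]: "Fbar k \<in> borel_measurable M"
      by (rule anchor_value_measurable) (use full in simp)
    have "Fbar k \<omega> = F (anch k \<omega>)" if "\<omega> \<in> space M" for \<omega>
      using full that unfolding full_batch_def by blast
    then have "AE \<omega> in M. cond_E M (G k)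
          (\<lambda>\<omega>. (norm (lsvrg_estimator FF b coin S Fbar x k \<omega> - F (x k \<omega>)))\<^sup>2) \<omega>
        = cond_E M (G k) (\<lambda>\<omega>. (norm (noise k \<omega>))\<^sup>2) \<omega>"
      unfolding estimator_error
      by (intro filtration.nn_cond_exp_cong AE_I2) simp_all
    then show "AE \<omega> in M.
        cond_E M (G k) (\<lambda>\<omega>. (norm (lsvrg_estimator FF b coin S Fbar x k \<omega> - F (x k \<omega>)))\<^sup>2) \<omega>
          \<le> cond_E M (G k) (Dh k) \<omega> \<and>
        cond_E M (G k) (Dh k) \<omega> \<le> ennreal ((1 - \<alpha> * p k) * prev 0 Dh k \<omega>
          + 1 / ((1 - \<alpha>) * real (b k) * p k) * E_bar D FF x k \<omega> + 0\<^sup>2)"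
      using cond_exp_noise[of k] cond_exp_Dh_recursion[OF \<alpha>, of k]
      by eventually_elim simp
  qed
qed (use VR_parameters[OF \<alpha>, of 1] Dh_nonneg in simp_all)

end

section \<open>The L-SVRG estimator\<close>

theorem lemma5:
  fixes M :: "'w measure" and D :: "'s measure"
    and FF :: "real ^ 'p \<Rightarrow> 's \<Rightarrow> real ^ 'p" and F :: "real ^ 'p \<Rightarrow> real ^ 'p"
    and G :: "nat \<Rightarrow> 'w measure"
    and x Fbar :: "nat \<Rightarrow> 'w \<Rightarrow> real ^ 'p"
    and coin :: "nat \<Rightarrow> 'w \<Rightarrow> bool"
    and S Sbar :: "nat \<Rightarrow> 'w \<Rightarrow> nat \<Rightarrow> 's"
    and b n :: "nat \<Rightarrow> nat" and p :: "nat \<Rightarrow> real"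
    and pmin \<sigma> :: real
  defines "Ft \<equiv> lsvrg_estimator FF b coin S Fbar x"
    and "Dhat \<equiv> Delta_hat D FF b coin x"
    and "Eb \<equiv> E_bar D FF x"
  assumes M: "prob_space M"
    and FF_meas: "(\<lambda>(y, \<xi>). FF y \<xi>) \<in> borel_measurable (borel \<Otimes>\<^sub>M D)"
    and setting: "finite_sum_setting D FF F \<or> expectation_setting D FF F \<sigma>"
    and sigma: "0 \<le> \<sigma>"
    and b: "\<forall>k. 1 \<le> b k" "\<forall>k. b k \<le> b (Suc k)"
    and n: "\<forall>k. 1 \<le> n k" "\<forall>k. n k \<le> n (Suc k)"
    and p: "0 < pmin" "\<forall>k. pmin \<le> p k \<and> p k < 1"
    and history: "history M D b n x coin S Sbar G"
    and fresh: "fresh_draws M D b n p coin S Sbar G"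
    and Fbar: "full_batch M F coin x Fbar \<or> mega_batch M FF F n \<sigma> coin Sbar x Fbar"
  shows
    "(\<forall>\<tau>>0. \<forall>k. AE \<omega> in M.
        cond_E M (G k) (\<lambda>\<omega>. (norm (Ft k \<omega> - F (x k \<omega>)))\<^sup>2) \<omega>
          \<le> ennreal (1 + \<tau>) * cond_E M (G k) (Dhat k) \<omega>
            + ennreal ((1 + \<tau>) / \<tau>)
                * cond_E M (G k) (\<lambda>\<omega>. (norm (Fbar k \<omega> - F (anchor coin x k \<omega>)))\<^sup>2) \<omega>)
     \<and> (\<forall>\<alpha>\<in>{0<..<1}.
        (\<forall>k. AE \<omega> in M.
          cond_E M (G k) (Dhat k) \<omega>
            \<le> ennreal ((1 - \<alpha> * p k) * prev 0 Dhat k \<omega>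
                        + 1 / ((1 - \<alpha>) * real (b k) * p k) * Eb k \<omega>))
        \<and> VR_property_init (2 * \<sigma>\<^sup>2 / real (n 0)) M G F x Eb Ft
            (\<lambda>k \<omega>. 2 * Dhat k \<omega> + 2 * \<sigma>\<^sup>2 / real (n k))
            (\<lambda>k. \<alpha> * p k)
            (\<lambda>k. 2 / ((1 - \<alpha>) * real (b k) * p k))
            (\<lambda>k. sqrt (2 * \<alpha> * p k * \<sigma>\<^sup>2 / real (n k)))
        \<and> VR_property M G F x Eb Ft
            (\<lambda>k \<omega>. 2 * Dhat k \<omega> + 2 * \<sigma>\<^sup>2 / real (n k))
            (\<lambda>k. \<alpha> * p k)
            (\<lambda>k. 2 / ((1 - \<alpha>) * real (b k) * p k))
            (\<lambda>k. if k = 0 then sqrt (2 * \<sigma>\<^sup>2 / real (n 0))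
                  else sqrt (2 * \<alpha> * p k * \<sigma>\<^sup>2 / real (n k)))
        \<and> (full_batch M F coin x Fbar \<longrightarrow>
            VR_property M G F x Eb Ft
              Dhat
              (\<lambda>k. \<alpha> * p k)
              (\<lambda>k. 1 / ((1 - \<alpha>) * real (b k) * p k))
              (\<lambda>k. 0)))"
proof -
  interpret M: prob_space M by (rule M)
  interpret oracle_D: square_integrable_oracle D FF F
    by (rule square_integrable_oracleI[OF FF_meas setting])
  have pk: "0 < p k" "p k < 1" for k
    using p(1) p(2)[rule_format, of k] by simp_all
  interpret lsvrg M D FF F G x coin S Sbar b n p
    using b pk history fresh by unfold_locales simp_all
  have inv_n: "2 * \<sigma>\<^sup>2 / real (n (Suc j)) \<le> 2 * \<sigma>\<^sup>2 / real (n j)" for j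
    using n(1)[rule_format, of j] n(2)[rule_format, of j] by (intro divide_left_mono) simp_all
  show ?thesis
    unfolding Ft_def Dhat_def Eb_def
  proof (intro conjI allI ballI impI)
    fix \<tau> :: real and k assume "0 < \<tau>"
    then show "AE \<omega> in M.
        cond_E M (G k) (\<lambda>\<omega>. (norm (lsvrg_estimator FF b coin S Fbar x k \<omega> - F (x k \<omega>)))\<^sup>2) \<omega>
          \<le> ennreal (1 + \<tau>) * cond_E M (G k) (Dh k) \<omega>
            + ennreal ((1 + \<tau>) / \<tau>)
                * cond_E M (G k) (\<lambda>\<omega>. (norm (Fbar k \<omega> - F (anch k \<omega>)))\<^sup>2) \<omega>"
      by (rule cond_exp_estimator[of Fbar k \<tau>, OF anchor_value_measurable[OF Fbar]])
  next
    fix \<alpha> :: real assume "\<alpha> \<in> {0<..<1}"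
    then have \<alpha>: "0 < \<alpha>" "\<alpha> < 1" by simp_all
    have \<alpha>p: "0 \<le> 1 - \<alpha> * p k" "0 \<le> \<alpha> * p k" for k
      using VR_parameters[OF \<alpha>, of 0 k] by simp_all
    have sq: "(sqrt (2 * \<alpha> * p k * \<sigma>\<^sup>2 / real (n k)))\<^sup>2 = \<alpha> * p k * (2 * \<sigma>\<^sup>2 / real (n k))" for k
      using \<alpha>(1) pk(1)[of k] by (simp add: ac_simps)
    \<comment> \<open>The budget: since the mega-batches grow, a share \<open>1 - \<alpha> * p k\<close> of the current anchor variance is
      covered by the previous one, and the remaining share \<open>\<alpha> * p k\<close> is the noise level.\<close>
    have split: "v = (1 - \<alpha> * p k) * v + \<alpha> * p k * v" for v k
      by (simp add: left_diff_distrib)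
    have step: "2 * \<sigma>\<^sup>2 / real (n (Suc j)) \<le> (1 - \<alpha> * p (Suc j)) * (2 * \<sigma>\<^sup>2 / real (n j))
        + (sqrt (2 * \<alpha> * p (Suc j) * \<sigma>\<^sup>2 / real (n (Suc j))))\<^sup>2" for j
      unfolding sq
      by (subst split[of _ "Suc j"]) (intro add_right_mono mult_left_mono inv_n \<alpha>p)
    show "AE \<omega> in M. cond_E M (G k) (Dh k) \<omega>
        \<le> ennreal ((1 - \<alpha> * p k) * prev 0 Dh k \<omega>
            + 1 / ((1 - \<alpha>) * real (b k) * p k) * E_bar D FF x k \<omega>)" for k
      by (rule cond_exp_Dh_recursion[OF \<alpha>])
    show "VR_property_init (2 * \<sigma>\<^sup>2 / real (n 0)) M G F x (E_bar D FF x)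
        (lsvrg_estimator FF b coin S Fbar x)
        (\<lambda>k \<omega>. 2 * Dh k \<omega> + 2 * \<sigma>\<^sup>2 / real (n k)) (\<lambda>k. \<alpha> * p k)
        (\<lambda>k. 2 / ((1 - \<alpha>) * real (b k) * p k))
        (\<lambda>k. sqrt (2 * \<alpha> * p k * \<sigma>\<^sup>2 / real (n k)))"
    proof (rule VR_property_anchor_noise[OF Fbar \<alpha>])
      show "0 \<le> sqrt (2 * \<alpha> * p k * \<sigma>\<^sup>2 / real (n k))" for k
        using pk(1)[of k] \<alpha> by simp
      show "2 * \<sigma>\<^sup>2 / real (n k) \<le> (1 - \<alpha> * p k)
          * (case k of 0 \<Rightarrow> 2 * \<sigma>\<^sup>2 / real (n 0) | Suc j \<Rightarrow> 2 * \<sigma>\<^sup>2 / real (n j))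
          + (sqrt (2 * \<alpha> * p k * \<sigma>\<^sup>2 / real (n k)))\<^sup>2" for k
      proof (cases k)
        case 0
        show ?thesis
          unfolding sq 0 by (subst split[of _ 0]) simp
      next
        case (Suc j)
        then show ?thesis using step[of j] by simp
      qed
    qed
    show "VR_property M G F x (E_bar D FF x) (lsvrg_estimator FF b coin S Fbar x)
        (\<lambda>k \<omega>. 2 * Dh k \<omega> + 2 * \<sigma>\<^sup>2 / real (n k)) (\<lambda>k. \<alpha> * p k)
        (\<lambda>k. 2 / ((1 - \<alpha>) * real (b k) * p k))
        (\<lambda>k. if k = 0 then sqrt (2 * \<sigma>\<^sup>2 / real (n 0))
              else sqrt (2 * \<alpha> * p k * \<sigma>\<^sup>2 / real (n k)))"
    proof (rule VR_property_anchor_noise[OF Fbar \<alpha>])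
      show "0 \<le> (if k = 0 then sqrt (2 * \<sigma>\<^sup>2 / real (n 0))
          else sqrt (2 * \<alpha> * p k * \<sigma>\<^sup>2 / real (n k)))" for k
        using pk(1)[of k] \<alpha> by simp
      show "2 * \<sigma>\<^sup>2 / real (n k) \<le> (1 - \<alpha> * p k)
          * (case k of 0 \<Rightarrow> 0 | Suc j \<Rightarrow> 2 * \<sigma>\<^sup>2 / real (n j))
          + (if k = 0 then sqrt (2 * \<sigma>\<^sup>2 / real (n 0))
              else sqrt (2 * \<alpha> * p k * \<sigma>\<^sup>2 / real (n k)))\<^sup>2" for k
      proof (cases k)
        case 0
        then show ?thesis by simp
      next
        case (Suc j)
        then show ?thesis using step[of j] by simp
      qed
    qed
    show "VR_property M G F x (E_bar D FF x) (lsvrg_estimator FF b coin S Fbar x) Dh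
        (\<lambda>k. \<alpha> * p k) (\<lambda>k. 1 / ((1 - \<alpha>) * real (b k) * p k)) (\<lambda>k. 0)"
      if "full_batch M F coin x Fbar"
      by (rule VR_property_full_batch[OF that \<alpha>])
  qed
qed

end
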